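(* Let $G$ be a $k$-connected graph with $k\geq 2$, and let $x$ and $z$ be two distinct vertices of $G$. If the average degree (in $G$) of the vertices of $G$ other than $x$ and $z$ is at least $r$, then for any subset $Y$ of $V(G)$ with $|Y|=k-2$, $G$ contains an $(x,Y,z)$-path of length at least $r$.
   Context: All graphs are finite and simple. For distinct vertices $x,z$ of $G$, an $(x,z)$-path is a path connecting $x$ and $z$ (i.e. with end vertices $x$ and $z$). For $Y\subseteq V(G)$, an $(x,Y,z)$-path is an $(x,z)$-path passing through all the vertices of $Y$. The length of a path is its number of edges. *)

theory Defs
  imports Complex_Main "Graph_Theory.Graph_Theory"
begin

text \<open>
  Finite simple graphs are the symmetric, loop-free, finite digraphs without parallel arcs
  (locale \<^locale>\<open>graph\<close>). Every undirected edge \<open>{u, v}\<close> is thus represented by exactly two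
  arcs, one from \<open>u\<close> to \<open>v\<close> and one from \<open>v\<close> to \<open>u\<close>, so that \<^const>\<open>out_degree\<close> is the usual
  vertex degree.
\<close>

text \<open>
  The unqualified name \<open>connected\<close> is also that of topological connectedness, hence the
  qualification below. The condition \<open>k < card (verts G)\<close> is the usual convention making the
  complete graph on \<open>n\<close> vertices \<open>(n - 1)\<close>-connected but not \<open>n\<close>-connected.
\<close>

definition k_connected :: "nat \<Rightarrow> ('a, 'b) pre_digraph \<Rightarrow> bool" where
  "k_connected k G \<longleftrightarrow>
     k < card (verts G) \<and>
     (\<forall>S \<subseteq> verts G. card S < k \<longrightarrow> Digraph_Component.connected (G \<restriction> (verts G - S)))"

definition average_degree_on :: "('a, 'b) pre_digraph \<Rightarrow> 'a set \<Rightarrow> real" where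
  "average_degree_on G A = (\<Sum>v\<in>A. real (out_degree G v)) / real (card A)"

definition path_through ::
    "('a, 'b) pre_digraph \<Rightarrow> 'a \<Rightarrow> 'a set \<Rightarrow> 'a \<Rightarrow> 'a vwalk \<Rightarrow> bool" where
  "path_through G x Y z p \<longleftrightarrow> vpath p G \<and> hd p = x \<and> last p = z \<and> Y \<subseteq> set p"

end

theory Submission
  imports Defs
begin

text \<open>
  Let \<open>P\<close> be a longest \<open>(x, Y, z)\<close>-path, of length \<open>L\<close>. A vertex of \<open>P\<close> has at most \<open>L\<close> neighbours
  on \<open>P\<close>. Hence it suffices that every component \<open>H\<close> of \<open>G - P\<close> satisfies
  \<open>2 e(H) + 2 e(H, P) - e(H, {x, z}) \<le> L |H|\<close>, and summation over the components gives the theorem.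
  Consecutive attachments of \<open>H\<close> to \<open>P\<close> that have no vertex of \<open>Y\<close> strictly between them are far
  apart on \<open>P\<close>, since the segment between them could be replaced by a detour through \<open>H\<close>. The at most
  \<open>k - 2\<close> other gaps split the at least \<open>k\<close> attachments into at most \<open>k - 1\<close> runs, so some run has
  two attachments. Merging the attachments of a run into two terminals reduces the bound for \<open>H\<close> to the
  case \<open>k = 2\<close> of the theorem for a smaller graph, unless a cut vertex of \<open>H\<close> cuts off a part of \<open>H\<close>
  that is not attached to the run. In that case \<open>H\<close> is split at the cut vertex, by induction on \<open>|H|\<close>.
\<close>

section \<open>Paths and boundaries\<close>

locale adjacency =
  fixes E :: "'a \<Rightarrow> 'a \<Rightarrow> bool"
  assumes sym: "E u v \<Longrightarrow> E v u" and irrefl: "\<not> E v v"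
begin

text \<open>For K inside U, an empty boundary says that K is a union of components of the graph on
  U. Components and separators are handled in this form throughout.\<close>

definition boundary :: "'a set \<Rightarrow> 'a set \<Rightarrow> 'a set" where
  "boundary U K = {v \<in> U - K. \<exists>u\<in>K. E u v}"

text \<open>Adjacent ordered pairs are counted: \<open>edge_count X X\<close> is twice the number of
  edges inside X, while edges between disjoint sets count once.\<close>

definition edge_count :: "'a set \<Rightarrow> 'a set \<Rightarrow> nat" where
  "edge_count X Z = (\<Sum>v\<in>X. card {u \<in> Z. E v u})"

definition is_path :: "'a set \<Rightarrow> 'a list \<Rightarrow> bool" where
  "is_path U q \<longleftrightarrow> q \<noteq> [] \<and> distinct q \<and> set q \<subseteq> U \<and> successively E q"

definition reach :: "'a set \<Rightarrow> 'a set \<Rightarrow> 'a set" where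
  "reach U S = {last q | q. is_path U q \<and> hd q \<in> S}"

section \<open>Edge counts, paths and reachability\<close>

lemma edge_count_Un_left:
  "finite X \<Longrightarrow> finite X' \<Longrightarrow> X \<inter> X' = {} \<Longrightarrow>
    edge_count (X \<union> X') Z = edge_count X Z + edge_count X' Z"
  by (simp add: edge_count_def sum.union_disjoint)

lemma edge_count_sym:
  assumes "finite X" "finite Z"
  shows "edge_count X Z = edge_count Z X"
proof -
  have eq: "card {u \<in> Z. E v u} = (\<Sum>u\<in>Z. of_bool (E v u))" if "finite Z" for v Z
    using that by (simp add: Int_def)
  have "edge_count X Z = (\<Sum>v\<in>X. \<Sum>u\<in>Z. of_bool (E v u))"
    by (simp only: edge_count_def eq[OF assms(2)])
  also have "\<dots> = (\<Sum>u\<in>Z. \<Sum>v\<in>X. of_bool (E v u))"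
    by (rule sum.swap)
  also have "\<dots> = (\<Sum>u\<in>Z. \<Sum>v\<in>X. of_bool (E u v))"
    by (intro sum.cong refl arg_cong[where f = of_bool]) (metis sym)
  also have "\<dots> = edge_count Z X"
    by (simp only: edge_count_def eq[OF assms(1)])
  finally show ?thesis .
qed

lemma edge_count_Un:
  assumes "finite X" "finite Z" "X \<inter> Z = {}"
  shows "edge_count (X \<union> Z) (X \<union> Z) = edge_count X X + edge_count Z Z + 2 * edge_count X Z"
proof -
  have "edge_count V (X \<union> Z) = edge_count V X + edge_count V Z" if "finite V" for V
    using assms that edge_count_Un_left[of X Z V]
    by (simp add: edge_count_sym[of V])
  then show ?thesis
    using assms edge_count_Un_left[of X Z "X \<union> Z"] edge_count_sym[of X Z] by simp
qed

lemma is_path_append: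
  "p \<noteq> [] \<Longrightarrow> q \<noteq> [] \<Longrightarrow>
    is_path U (p @ q) \<longleftrightarrow> is_path U p \<and> is_path U q \<and> set p \<inter> set q = {} \<and> E (last p) (hd q)"
  by (auto simp: is_path_def successively_append_iff)

lemma is_path_appendD:
  assumes "is_path U (p @ q)"
  shows "p \<noteq> [] \<Longrightarrow> is_path U p" "q \<noteq> [] \<Longrightarrow> is_path U q"
  using assms by (auto simp: is_path_def successively_append_iff)

lemma is_path_rev: "is_path U (rev q) \<longleftrightarrow> is_path U q"
proof -
  have "successively (\<lambda>x y. E y x) q \<longleftrightarrow> successively E q"
    by (metis (full_types) sym successively_mono)
  then show ?thesis by (simp add: is_path_def)
qed

lemma is_path_mono: "is_path U q \<Longrightarrow> U \<subseteq> V \<Longrightarrow> is_path V q"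
  by (auto simp: is_path_def)

lemma is_path_hd_last: "is_path U q \<Longrightarrow> hd q \<in> U \<and> last q \<in> U"
  by (auto simp: is_path_def)

lemma is_path_length_pos: "is_path U q \<Longrightarrow> 1 \<le> length q"
  by (cases q) (auto simp: is_path_def)

lemma is_path_length: "is_path U q \<Longrightarrow> finite U \<Longrightarrow> length q \<le> card U"
  unfolding is_path_def by (metis card_mono distinct_card)

lemma reach_subset: "reach U S \<subseteq> U"
  by (auto simp: reach_def dest: is_path_hd_last)

lemma subset_reach: "S \<inter> U \<subseteq> reach U S"
proof
  fix v assume "v \<in> S \<inter> U"
  then show "v \<in> reach U S"
    unfolding reach_def by (intro CollectI exI[of _ "[v]"]) (simp add: is_path_def)
qed

text \<open>A path that ends next to an unreached vertex v can be extended by v, since all vertices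
  on it are reached by its initial parts. This turns assumptions on boundaries into paths.\<close>

lemma boundary_reach: "boundary U (reach U S) = {}"
proof (rule ccontr)
  assume "boundary U (reach U S) \<noteq> {}"
  then obtain q v where q: "is_path U q" "hd q \<in> S" and v: "v \<in> U" "v \<notin> reach U S" "E (last q) v"
    by (auto simp: boundary_def reach_def)
  have "v \<notin> set q"
  proof
    assume "v \<in> set q"
    then obtain a b where "q = (a @ [v]) @ b" by (metis append.assoc append_Cons append_Nil split_list)
    then have "is_path U (a @ [v])" "hd (a @ [v]) = hd q"
      using q(1) by (auto simp: is_path_def successively_append_iff hd_append)
    then show False using v(2) q(2) unfolding reach_def
      by (metis (mono_tags, lifting) last_snoc mem_Collect_eq)
  qed
  moreover have "q \<noteq> []" using q(1) by (simp add: is_path_def)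
  ultimately have "is_path U (q @ [v])" "hd (q @ [v]) = hd q"
    using q(1) v by (auto simp: is_path_append) (auto simp: is_path_def)
  then show False using v(2) q(2) unfolding reach_def
    by (metis (mono_tags, lifting) last_snoc mem_Collect_eq)
qed

text \<open>Menger's theorem for two paths: the hypothesis says that no vertex separates \<open>A\<close> from \<open>T\<close>,
  \<open>K\<close> being the part reachable from \<open>A\<close> once \<open>w\<close> is deleted.\<close>

lemma two_disjoint_paths:
  assumes "finite U" "A \<subseteq> U" "T \<subseteq> U"
    and "\<And>w K. K \<subseteq> U \<Longrightarrow> A \<subseteq> insert w K \<Longrightarrow> boundary U K \<subseteq> {w} \<Longrightarrow> K \<inter> T \<noteq> {}"
  shows "\<exists>p q. is_path U p \<and> is_path U q \<and> set p \<inter> set q = {} \<and> hd p \<in> A \<and> hd q \<in> A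
    \<and> last p \<in> T \<and> last q \<in> T \<and> set (butlast p) \<inter> T = {} \<and> set (butlast q) \<inter> T = {}"
  using assms
proof (induction "card U" arbitrary: U A rule: less_induct)
  case less
  note nosep = less.prems(4)
  \<comment> \<open>With K empty, the hypothesis forbids a single vertex from covering A.\<close>
  have two: "\<not> A \<subseteq> {w}" for w
    using nosep[of "{}" w] by (auto simp: boundary_def)
  show ?case
  proof (cases "A \<subseteq> T")
    case True
    obtain a b where "a \<in> A" "b \<in> A" "a \<noteq> b" using two by blast
    then show ?thesis using True less.prems(2)
      by (intro exI[of _ "[a]"] exI[of _ "[b]"]) (auto simp: is_path_def)
  next
    case False
    then obtain a where a: "a \<in> A" "a \<notin> T" by auto
    define U' where "U' = U - {a}"
    have aU: "a \<in> U" using a less.prems(2) by auto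
    then have U': "finite U'" "card U' < card U" "T \<subseteq> U'" "U' \<subseteq> U"
      using less.prems(1,3) a(2) card_Diff1_less[of U a] by (auto simp: U'_def)
    show ?thesis
    proof (cases "\<exists>u\<in>U - A. E a u")
      case no_nbr: False
      have "K \<inter> T \<noteq> {}" if "K \<subseteq> U'" "A - {a} \<subseteq> insert w K" "boundary U' K \<subseteq> {w}" for w K
      proof -
        have "insert a K \<inter> T \<noteq> {}"
        proof (rule nosep[of _ w])
          show "insert a K \<subseteq> U" "A \<subseteq> insert w (insert a K)" using that aU U'(4) by auto
          show "boundary U (insert a K) \<subseteq> {w}"
            using that no_nbr by (auto simp: boundary_def U'_def)
        qed
        then show ?thesis using a(2) by auto
      qed
      then obtain p q where "is_path U' p \<and> is_path U' q \<and> set p \<inter> set q = {} \<and> hd p \<in> A - {a} \<and>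
        hd q \<in> A - {a} \<and> last p \<in> T \<and> last q \<in> T \<and> set (butlast p) \<inter> T = {} \<and> set (butlast q) \<inter> T = {}"
        using less.hyps[OF U'(2,1) _ U'(3), of "A - {a}"] less.prems(2) unfolding U'_def by blast
      then show ?thesis using is_path_mono[OF _ U'(4)] by blast
    next
      case True
      then obtain u where u: "u \<in> U" "u \<notin> A" "E a u" by auto
      \<comment> \<open>The start a is moved one step to u. In a pair of paths from A' avoiding a,
        the path starting at u, if there is one, gets a prepended.\<close>
      define A' where "A' = insert u (A - {a})"
      have A'U: "A' \<subseteq> U'" using u a less.prems(2) irrefl by (auto simp: A'_def U'_def)
      show ?thesis
      proof (cases "\<forall>w K. K \<subseteq> U' \<longrightarrow> A' \<subseteq> insert w K \<longrightarrow> boundary U' K \<subseteq> {w} \<longrightarrow> K \<inter> T \<noteq> {}")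
        case True
        then obtain p q where pq: "is_path U' p" "is_path U' q" "set p \<inter> set q = {}" "hd p \<in> A'"
          "hd q \<in> A'" "last p \<in> T" "last q \<in> T" "set (butlast p) \<inter> T = {}" "set (butlast q) \<inter> T = {}"
          using less.hyps[OF U'(2,1) A'U U'(3)] by blast
        define ext where "ext r = (if hd r = u then a # r else r)" for r
        have ext: "is_path U (ext r)" "hd (ext r) \<in> A" "last (ext r) \<in> T" "set (butlast (ext r)) \<inter> T = {}"
          if "is_path U' r" "hd r \<in> A'" "last r \<in> T" "set (butlast r) \<inter> T = {}" for r
        proof -
          have r: "is_path U r" "r \<noteq> []" "a \<notin> set r"
            using that(1) U'(4) by (auto simp: is_path_def U'_def)
          then have "is_path U (a # r)" if "hd r = u"
            using is_path_append[of "[a]" r U] u aU that by (simp add: is_path_def)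
          then show "is_path U (ext r)" using r by (simp add: ext_def)
          show "hd (ext r) \<in> A" using that(2) a by (auto simp: ext_def A'_def)
          show "last (ext r) \<in> T" using that(3) r by (auto simp: ext_def)
          show "set (butlast (ext r)) \<inter> T = {}" using that(4) r a by (auto simp: ext_def)
        qed
        have "p \<noteq> []" "q \<noteq> []" using pq by (auto simp: is_path_def)
        then have "hd p \<noteq> hd q" using pq(3) by (metis disjoint_iff list.set_sel(1))
        moreover have "a \<notin> set p" "a \<notin> set q" using pq by (auto simp: is_path_def U'_def)
        ultimately have "set (ext p) \<inter> set (ext q) = {}" using pq(3) by (auto simp: ext_def)
        then show ?thesis using ext[of p] ext[of q] pq by blast
      next
        case False
        \<comment> \<open>Now w separates A' from T in U - {a}, so a and w together separate A from
          T in U. The induction hypothesis links {a, w} to T in the smaller set U - K, on the far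
          side of the separation.\<close>
        then obtain w K where K: "K \<subseteq> U'" "A' \<subseteq> insert w K" "boundary U' K \<subseteq> {w}" "K \<inter> T = {}"
          by blast
        have KU: "K \<subseteq> U" "a \<notin> K" using K(1) by (auto simp: U'_def)
        have bdU: "boundary U Z \<subseteq> insert a (boundary U' Z)" for Z by (auto simp: boundary_def U'_def)
        have "\<not> A' \<subseteq> {w}"
        proof
          assume "A' \<subseteq> {w}"
          then have "A \<subseteq> {a}" using u(2) by (auto simp: A'_def)
          then show False using two by blast
        qed
        then have "K \<noteq> {}" using K(2) by auto
        have wU: "w \<in> U'" "w \<notin> K"
        proof -
          have "w \<in> U' - K"
          proof (rule ccontr)
            assume w: "w \<notin> U' - K"
            then have "boundary U' K = {}" using K(3) by (auto simp: boundary_def)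
            then have "boundary U K \<subseteq> {a}" using bdU[of K] by auto
            moreover have "A' \<subseteq> K" using w K(2) A'U by auto
            then have "A \<subseteq> insert a K" by (auto simp: A'_def)
            ultimately show False using nosep[of K a] K(4) KU(1) by blast
          qed
          then show "w \<in> U'" "w \<notin> K" by auto
        qed
        define U2 where "U2 = U - K"
        have "card U2 < card U" using \<open>K \<noteq> {}\<close> KU less.prems(1)
          unfolding U2_def by (intro psubset_card_mono) auto
        moreover have "finite U2" "U2 \<subseteq> U" "T \<subseteq> U2" "{a, w} \<subseteq> U2"
          using less.prems K(4) KU aU wU U'(4) by (auto simp: U2_def)
        moreover have "K2 \<inter> T \<noteq> {}"
          if K2: "K2 \<subseteq> U2" "{a, w} \<subseteq> insert v K2" "boundary U2 K2 \<subseteq> {v}" for v K2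
        proof -
          have "(K \<union> K2) \<inter> T \<noteq> {}"
          proof (rule nosep[of _ v])
            show "K \<union> K2 \<subseteq> U" using K2(1) KU by (auto simp: U2_def)
            show "A \<subseteq> insert v (K \<union> K2)" using K(2) K2(2) by (auto simp: A'_def)
            show "boundary U (K \<union> K2) \<subseteq> {v}"
            proof
              fix x assume x: "x \<in> boundary U (K \<union> K2)"
              then have "x \<in> boundary U K \<or> x \<in> boundary U2 K2" and "x \<notin> K2"
                by (auto simp: boundary_def U2_def)
              moreover have "boundary U K \<subseteq> {a, w}" using bdU[of K] K(3) by auto
              ultimately show "x \<in> {v}" using K2(2,3) by auto
            qed
          qed
          then show ?thesis using K(4) by auto
        qed
        ultimately obtain p q where pq: "is_path U2 p" "is_path U2 q" "set p \<inter> set q = {}"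
          "hd p \<in> {a, w}" "hd q \<in> {a, w}" "last p \<in> T" "last q \<in> T"
          "set (butlast p) \<inter> T = {}" "set (butlast q) \<inter> T = {}"
          using less.hyps[of U2 "{a, w}"] by blast
        have "p \<noteq> []" "q \<noteq> []" using pq by (auto simp: is_path_def)
        then have "hd p \<noteq> hd q" using pq(3) by (metis disjoint_iff list.set_sel(1))
        then obtain p q where p: "is_path U2 p" "hd p = a" "last p \<in> T" "set (butlast p) \<inter> T = {}"
          and q: "is_path U2 q" "hd q = w" "last q \<in> T" "set (butlast q) \<inter> T = {}"
          and pq: "set p \<inter> set q = {}"
        proof (cases "hd p = a")
          case True
          then show ?thesis using that[of p q] pq \<open>hd p \<noteq> hd q\<close> by auto
        next
          case False
          then show ?thesis using that[of q p] pq \<open>hd p \<noteq> hd q\<close> by auto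
        qed
        have p': "is_path U p" and q': "is_path U q"
          using p q is_path_mono \<open>U2 \<subseteq> U\<close> by blast+
        have "a \<noteq> w" using wU(1) by (auto simp: U'_def)
        show ?thesis
        proof (cases "w \<in> A")
          case True
          then show ?thesis using p p' q q' pq a by blast
        next
          case False
          \<comment> \<open>The path from w has to be prolonged backwards through K to a start in A
            - {a}. If no such prolongation existed, a alone would separate A from T.\<close>
          define Z where "Z = reach K (A - {a})"
          have ZK: "Z \<subseteq> K" unfolding Z_def by (rule reach_subset)
          have AK: "A - {a} \<subseteq> K" using K(2) False by (auto simp: A'_def)
          then have AZ: "A - {a} \<subseteq> Z" using subset_reach[of "A - {a}" K] by (auto simp: Z_def)
          have "\<exists>v\<in>Z. E v w"
          proof (rule ccontr)
            assume no: "\<not> ?thesis"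
            have "boundary K Z = {}" unfolding Z_def by (rule boundary_reach)
            have "boundary U Z \<subseteq> {a}"
            proof
              fix x assume "x \<in> boundary U Z"
              then obtain v where v: "v \<in> Z" "E v x" "x \<in> U" "x \<notin> Z"
                by (auto simp: boundary_def)
              then have "x \<notin> K" "x \<noteq> w"
                using \<open>boundary K Z = {}\<close> no by (auto simp: boundary_def)
              then have "x \<in> boundary U K" using v ZK by (auto simp: boundary_def)
              then show "x \<in> {a}" using bdU[of K] K(3) \<open>x \<noteq> w\<close> by auto
            qed
            then show False using nosep[of Z a] AZ ZK KU K(4) by blast
          qed
          then obtain r where r: "is_path K r" "hd r \<in> A - {a}" "E (last r) w"
            unfolding Z_def reach_def by blast
          have "r \<noteq> []" "q \<noteq> []" using r q by (auto simp: is_path_def)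
          moreover have "set r \<subseteq> K" using r by (simp add: is_path_def)
          moreover have "set q \<inter> K = {}" "set p \<inter> K = {}" using q p by (auto simp: is_path_def U2_def)
          moreover have "is_path U r" using r is_path_mono KU by blast
          ultimately have "is_path U (r @ q)" "hd (r @ q) \<in> A" "last (r @ q) \<in> T"
            "set (butlast (r @ q)) \<inter> T = {}" "set p \<inter> set (r @ q) = {}"
            using r q q' K(4) pq by (auto simp: is_path_append butlast_append)
          then show ?thesis using p p' a by blast
        qed
      qed
    qed
  qed
qed

section \<open>Paths through prescribed vertices\<close>

text \<open>The fan form of Menger's theorem: two disjoint paths from the neighbours of y to T in U
  - {y} are joined at y, one of them reversed. They stop at their first vertex in T, so the inner
  vertices avoid T.\<close>

lemma two_fan:
  assumes fin: "finite U" and y: "y \<in> U" "y \<notin> T" and T: "T \<subseteq> U"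
    and nosep: "\<And>w K. K \<subseteq> U \<Longrightarrow> y \<in> K \<Longrightarrow> boundary U K \<subseteq> {w} \<Longrightarrow> K \<inter> T \<noteq> {}"
  obtains s q t where "is_path U (s # q @ [t])" "s \<in> T" "t \<in> T" "y \<in> set q" "set q \<inter> T = {}"
proof -
  define U' where "U' = U - {y}"
  define A where "A = {u \<in> U'. E y u}"
  have "K \<inter> T \<noteq> {}" if K: "K \<subseteq> U'" "A \<subseteq> insert w K" "boundary U' K \<subseteq> {w}" for w K
  proof -
    have "boundary U (insert y K) \<subseteq> {w}"
    proof
      fix v assume "v \<in> boundary U (insert y K)"
      then have "v \<in> A \<or> v \<in> boundary U' K" "v \<notin> K"
        by (auto simp: boundary_def A_def U'_def)
      then show "v \<in> {w}" using K(2,3) by blast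
    qed
    then have "insert y K \<inter> T \<noteq> {}"
      using K(1) y(1) by (intro nosep[of _ w]) (auto simp: U'_def)
    then show ?thesis using y(2) by auto
  qed
  moreover have "finite U'" "A \<subseteq> U'" "T \<subseteq> U'" using fin T y by (auto simp: U'_def A_def)
  ultimately obtain p q where pq: "is_path U' p" "is_path U' q" "set p \<inter> set q = {}" "hd p \<in> A"
    "hd q \<in> A" "last p \<in> T" "last q \<in> T" "set (butlast p) \<inter> T = {}" "set (butlast q) \<inter> T = {}"
    using two_disjoint_paths[of U' A T] by blast
  have ne: "p \<noteq> []" "q \<noteq> []" using pq by (auto simp: is_path_def)
  have "U' \<subseteq> U" by (auto simp: U'_def)
  then have U: "is_path U (rev p)" "is_path U q"
    using pq(1,2) is_path_mono is_path_rev by blast+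
  have yn: "y \<notin> set p" "y \<notin> set q"
    using pq(1,2) by (auto simp: is_path_def U'_def)
  have "is_path U (y # q)"
    using is_path_append[of "[y]" q U] ne U yn pq(5) y(1) by (auto simp: is_path_def A_def)
  then have "is_path U (rev p @ y # q)"
    using is_path_append[of "rev p" "y # q" U] ne U yn pq(3,4) sym[of y "hd p"]
    by (auto simp: A_def last_rev)
  moreover have "rev p = last p # rev (butlast p)" "q = butlast q @ [last q]"
    using ne by (metis append_butlast_last_id rev_eq_Cons_iff rev_rev_ident, simp)
  ultimately have "is_path U (last p # (rev (butlast p) @ y # butlast q) @ [last q])"
    by (metis append.assoc append_Cons)
  then show ?thesis using pq(6-9) y(2)
    by (intro that[of "last p" "rev (butlast p) @ y # butlast q" "last q"]) auto
qed

text \<open>A path through \<open>Y'\<close> has at most \<open>card Y' + 1\<close> segments between vertices of \<open>Y'\<close>. If no segment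
  could be rerouted through \<open>y\<close>, then a single vertex would separate \<open>y\<close> from each segment, and these
  vertices together would separate \<open>y\<close> from the path.\<close>

lemma path_through_insert:
  assumes V: "finite V" and conn: "\<And>K. K \<subseteq> V \<Longrightarrow> K \<noteq> {} \<Longrightarrow> card (boundary V K) < k \<Longrightarrow> K \<union> boundary V K = V"
    and P: "is_path V P" "hd P \<noteq> last P" "Y \<subseteq> set P" "hd P \<notin> Y" "last P \<notin> Y"
    and y: "y \<in> V" "y \<notin> set P" and k: "card Y + 2 \<le> k"
  shows "\<exists>P'. is_path V P' \<and> hd P' = hd P \<and> last P' = last P \<and> insert y Y \<subseteq> set P'"
proof -
  define n where "n = length P"
  have P': "P \<noteq> []" "distinct P" "set P \<subseteq> V" "successively E P" "0 < n"
    using P(1) by (auto simp: is_path_def n_def)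
  define I where "I = {i. i < n \<and> P ! i \<in> Y}"
  have "card I \<le> card Y"
  proof (rule card_inj_on_le)
    show "inj_on ((!) P) I" using P'(2) by (auto simp: inj_on_def I_def n_def nth_eq_iff_index_eq)
    show "finite Y" using P(3) finite_subset by blast
  qed (auto simp: I_def)
  \<comment> \<open>Segments of P start at the first vertex and at each vertex of Y.\<close>
  define St where "St = insert 0 I"
  have finSt: "finite St" by (simp add: St_def I_def)
  have cardSt: "card St \<le> card Y + 1"
    using \<open>card I \<le> card Y\<close> by (auto simp: St_def card_insert_if I_def)
  \<comment> \<open>A segment runs up to and including the next vertex of Y, so neighbouring
    segments share an end.\<close>
  define seg where "seg a = {P ! t | t. a \<le> t \<and> t < n \<and> {a<..<t} \<inter> I = {}}" for a
  have seg_sub: "seg a \<subseteq> set P" for a by (auto simp: seg_def n_def)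
  have cover: "\<exists>a\<in>St. v \<in> seg a" if v: "v \<in> set P" for v
  proof -
    obtain t where t: "t < n" "v = P ! t" using v by (metis in_set_conv_nth n_def)
    define a where "a = Max (St \<inter> {..t})"
    have a: "a \<in> St \<inter> {..t}" unfolding a_def using finSt by (intro Max_in) (auto simp: St_def)
    have "{a<..<t} \<inter> I = {}"
    proof (rule ccontr)
      assume "{a<..<t} \<inter> I \<noteq> {}"
      then obtain i where i: "i \<in> I" "a < i" "i < t" by auto
      then have "i \<le> a" unfolding a_def using finSt by (intro Max_ge) (auto simp: St_def)
      then show False using i by simp
    qed
    then show ?thesis using a t by (auto simp: seg_def)
  qed
  \<comment> \<open>A fan from y inside \<open>U a\<close> meets P only in the segment, so it can
    replace the part of P between its two ends. \<open>Q a w K\<close> says that w separates y from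
    the segment in \<open>U a\<close>, which is the obstruction to such a fan.\<close>
  define U where "U a = (V - set P) \<union> seg a" for a
  define Q where "Q a w K \<longleftrightarrow>
      K \<subseteq> U a \<and> y \<in> K \<and> boundary (U a) K \<subseteq> {w} \<and> K \<inter> seg a = {}" for a w K
  show ?thesis
  proof (cases "\<exists>a\<in>St. \<forall>w K. \<not> Q a w K")
    case True
    then obtain a where a: "a \<in> St" "\<And>w K. \<not> Q a w K" by auto
    have U: "finite (U a)" "y \<in> U a" "y \<notin> seg a" "seg a \<subseteq> U a" "U a \<subseteq> V"
      using V y seg_sub[of a] P'(3) finite_subset[OF seg_sub[of a]] by (auto simp: U_def)
    \<comment> \<open>The part of P strictly between positions s and t is exchanged for q. Both ends
      lie in one segment, so no vertex of Y is lost.\<close>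
    have exch: ?thesis
      if st: "s < t" "P ! s \<in> seg a" "P ! t \<in> seg a" "t < n"
        and q: "is_path (U a) (P ! s # q @ [P ! t])" "y \<in> set q" "set q \<inter> seg a = {}" for s t q
    proof -
      define P1 where "P1 = take (Suc s) P"
      define P2 where "P2 = drop t P"
      have qP: "set q \<inter> set P = {}" "q \<noteq> []" using q by (auto simp: is_path_def U_def)
      have sl: "s < length P" "t < length P" using st by (simp_all add: n_def)
      have P12: "P1 \<noteq> []" "P2 \<noteq> []" "last P1 = P ! s" "hd P2 = P ! t"
        using sl P'(1) by (simp_all add: P1_def P2_def hd_drop_conv_nth take_Suc_conv_app_nth)
      have "is_path V P1" "is_path V P2"
        using is_path_appendD(1)[of V P1 "drop (Suc s) P"] is_path_appendD(2)[of V "take t P" P2] P(1) P12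
        by (simp_all add: P1_def P2_def)
      moreover have qV: "is_path V (P ! s # q @ [P ! t])" using q(1) is_path_mono U(5) by blast
      then have "is_path V q" "E (P ! s) (hd q)" "E (last q) (P ! t)"
        using qP(2) by (auto simp: is_path_def successively_append_iff successively_Cons hd_append)
      moreover have "set P1 \<inter> set P2 = {}"
        unfolding P1_def P2_def using st P'(2) by (intro set_take_disj_set_drop_if_distinct) auto
      moreover have "set P1 \<subseteq> set P" "set P2 \<subseteq> set P"
        by (auto simp: P1_def P2_def dest: in_set_takeD in_set_dropD)
      ultimately have path: "is_path V (P1 @ q @ P2)"
        using P12 qP by (subst is_path_append, simp, simp, subst is_path_append) auto
      have between: "\<not> (s < i \<and> i < t)" if "i \<in> I" for i
      proof -
        obtain s' t' where "P ! s = P ! s'" "a \<le> s'" "s' < n"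
          "P ! t = P ! t'" "t' < n" "{a<..<t'} \<inter> I = {}"
          using st(2,3) by (auto simp: seg_def)
        then have "a \<le> s" "{a<..<t} \<inter> I = {}"
          using P'(2) sl by (auto simp: n_def nth_eq_iff_index_eq)
        moreover have "i \<in> {a<..<t} \<inter> I" if "s < i" "i < t" using that \<open>i \<in> I\<close> \<open>a \<le> s\<close> by simp
        ultimately show ?thesis by blast
      qed
      have "Y \<subseteq> set (P1 @ q @ P2)"
      proof
        fix v assume v: "v \<in> Y"
        then have "v \<in> set P" using P(3) by auto
        then obtain i where i: "i < length P" "P ! i = v" by (auto simp: in_set_conv_nth)
        then have "i \<in> I" using v by (simp add: I_def n_def)
        then consider "i < Suc s" | "t \<le> i" using between by fastforce
        then show "v \<in> set (P1 @ q @ P2)"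
        proof cases
          case 1
          then have "P ! i \<in> set P1" using i by (auto simp: P1_def in_set_conv_nth)
          then show ?thesis using i by simp
        next
          case 2
          then have "P2 ! (i - t) = v" "i - t < length P2" using i by (auto simp: P2_def)
          then have "v \<in> set P2" by (metis nth_mem)
          then show ?thesis by simp
        qed
      qed
      moreover have "hd (P1 @ q @ P2) = hd P" "last (P1 @ q @ P2) = last P"
        using P12 P'(1) sl by (simp_all add: P1_def P2_def)
      ultimately show ?thesis using path q(2) by (intro exI[of _ "P1 @ q @ P2"]) auto
    qed
    obtain s q t where q: "is_path (U a) (s # q @ [t])" "s \<in> seg a" "t \<in> seg a" "y \<in> set q"
      "set q \<inter> seg a = {}"
    proof (rule two_fan[OF U(1-4)])
      show "K \<inter> seg a \<noteq> {}" if "K \<subseteq> U a" "y \<in> K" "boundary (U a) K \<subseteq> {w}" for w K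
        using a(2)[of w K] that by (simp add: Q_def)
    qed
    obtain i j where ij: "i < n" "s = P ! i" "j < n" "t = P ! j"
      using q(2,3) by (auto simp: seg_def)
    have "i \<noteq> j" using q(1) ij by (auto simp: is_path_def)
    then consider "i < j" | "j < i" by linarith
    then show ?thesis
    proof cases
      case 1
      show ?thesis by (rule exch[OF 1]) (use q ij in auto)
    next
      case 2
      have "is_path (U a) (rev (s # q @ [t]))" using q(1) is_path_rev by blast
      then have r: "is_path (U a) (P ! j # rev q @ [P ! i])" using ij by simp
      show ?thesis by (rule exch[where q = "rev q", OF 2]) (use r q ij in auto)
    qed
  next
    case False
    have "\<forall>a\<in>St. \<exists>w K. Q a w K" using False by simp
    then obtain w where "\<forall>a\<in>St. \<exists>K. Q a (w a) K" by (rule bchoice[THEN exE])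
    then obtain K where "\<forall>a\<in>St. Q a (w a) (K a)" by (rule bchoice[THEN exE])
    then have wK: "K a \<subseteq> U a \<and> y \<in> K a \<and> boundary (U a) (K a) \<subseteq> {w a} \<and> K a \<inter> seg a = {}"
      if "a \<in> St" for a
      using that unfolding Q_def by blast
    \<comment> \<open>A vertex on the boundary of the intersection lies outside some
      \<open>K a\<close> while belonging to \<open>U a\<close>, hence equals \<open>w a\<close>. So
      Z has at most \<open>card Y + 1\<close> boundary vertices.\<close>
    define Z where "Z = (\<Inter>a\<in>St. K a)"
    have Z: "y \<in> Z" "Z \<subseteq> V - set P"
    proof -
      show "y \<in> Z" using wK by (auto simp: Z_def)
      have "0 \<in> St" by (simp add: St_def)
      then show "Z \<subseteq> V - set P" using wK[of 0] by (auto simp: Z_def U_def)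
    qed
    have "boundary V Z \<subseteq> w ` St"
    proof
      fix v assume "v \<in> boundary V Z"
      then obtain u where u: "u \<in> Z" "E u v" "v \<in> V" "v \<notin> Z" by (auto simp: boundary_def)
      obtain a where a: "a \<in> St" "v \<in> U a" "v \<notin> K a"
      proof (cases "v \<in> set P")
        case True
        then obtain a where "a \<in> St" "v \<in> seg a" using cover by blast
        then show ?thesis using that wK[of a] by (auto simp: U_def)
      next
        case False
        then show ?thesis using that u by (auto simp: Z_def U_def)
      qed
      then have "v \<in> boundary (U a) (K a)" using u by (auto simp: boundary_def Z_def)
      then have "v = w a" using wK[OF a(1)] by auto
      then show "v \<in> w ` St" using a(1) by blast
    qed
    then have "card (boundary V Z) \<le> card (w ` St)" using finSt by (intro card_mono) auto
    also have "\<dots> \<le> card St" by (rule card_image_le[OF finSt])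
    finally have le: "card (boundary V Z) \<le> card Y + 1" using cardSt by simp
    then have "Z \<union> boundary V Z = V" using Z k by (intro conn) auto
    \<comment> \<open>By connectivity the boundary of Z contains all of P, in particular both ends
      and Y, which are \<open>card Y + 2\<close> vertices: a contradiction.\<close>
    then have "set P \<subseteq> boundary V Z" using Z(2) P'(3) by blast
    then have "insert (hd P) (insert (last P) Y) \<subseteq> boundary V Z"
      using P'(1) P(3) by auto
    then have "card (insert (hd P) (insert (last P) Y)) \<le> card (boundary V Z)"
      using V by (intro card_mono) (auto simp: boundary_def)
    moreover have "finite Y" using P(3) finite_subset by blast
    ultimately show ?thesis using le P(2,4,5) by simp
  qed
qed

text \<open>The vertices of Y are inserted one at a time into a path given by connectivity. Up to k
  - 1 vertices may be prescribed, one more than in the theorem; this later guarantees a path that is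
  long enough to start from.\<close>

lemma path_through_set:
  assumes V: "finite V" and conn: "\<And>K. K \<subseteq> V \<Longrightarrow> K \<noteq> {} \<Longrightarrow> card (boundary V K) < k \<Longrightarrow> K \<union> boundary V K = V"
    and xz: "x \<in> V" "z \<in> V" "x \<noteq> z" and k: "0 < k"
    and Y: "Y \<subseteq> V - {x, z}" "card Y < k"
  shows "\<exists>P. is_path V P \<and> hd P = x \<and> last P = z \<and> Y \<subseteq> set P"
proof -
  have "finite Y" using Y(1) V finite_subset by blast
  then show ?thesis using Y
  proof (induction Y)
    case empty
    have "reach V {x} \<noteq> {}" using subset_reach[of "{x}" V] xz(1) by auto
    then have "reach V {x} = V"
      using conn[OF reach_subset, of "{x}"] boundary_reach[of V "{x}"] k by auto
    then have "z \<in> reach V {x}" using xz(2) by simp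
    then show ?case by (auto simp: reach_def)
  next
    case (insert y Y)
    then obtain P where P: "is_path V P" "hd P = x" "last P = z" "Y \<subseteq> set P" by auto
    show ?case
    proof (cases "y \<in> set P")
      case False
      have "\<exists>P'. is_path V P' \<and> hd P' = hd P \<and> last P' = last P \<and> insert y Y \<subseteq> set P'"
      proof (rule path_through_insert[OF V conn P(1)])
        show "card Y + 2 \<le> k" using insert.hyps insert.prems(2) by simp
      qed (use P xz(3) False insert.prems(1) in auto)
      then show ?thesis unfolding P(2,3) .
    qed (use P in auto)
  qed
qed

section \<open>Degree sums and attachments\<close>

text \<open>\<open>A\<close> and \<open>C\<close> play the neighbourhoods of two further vertices \<open>x\<close> and \<open>z\<close>, and the sum in
  the first disjunct counts the neighbours of \<open>K\<close> in the graph on \<open>W \<union> {x, z}\<close>.\<close>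

definition rooted_conn :: "nat \<Rightarrow> 'a set \<Rightarrow> 'a set \<Rightarrow> 'a set \<Rightarrow> bool" where
  "rooted_conn k W A C \<longleftrightarrow> (\<forall>K \<subseteq> W. K \<noteq> {} \<longrightarrow>
     k \<le> card (boundary W K) + of_bool (K \<inter> A \<noteq> {}) + of_bool (K \<inter> C \<noteq> {}) \<or>
     K \<union> boundary W K = W \<and> K \<inter> A \<noteq> {} \<and> K \<inter> C \<noteq> {})"

text \<open>The case k = 2 of the theorem, with the ends x and z represented by their neighbourhoods
  A and C. The left side is the degree sum over W, and x, q, z form a path with
  \<open>length q + 1\<close> edges.\<close>

definition forces_long_path :: "'a set \<Rightarrow> bool" where
  "forces_long_path W \<longleftrightarrow> (\<forall>A C. rooted_conn 2 W A C \<longrightarrow>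
     (\<exists>q. is_path W q \<and> hd q \<in> A \<and> last q \<in> C \<and>
       edge_count W W + card (W \<inter> A) + card (W \<inter> C) \<le> card W * (length q + 1)))"

text \<open>\<open>B i\<close> is the set of neighbours in \<open>H\<close> of the \<open>i\<close>-th attachment and \<open>\<rho> i\<close> is its run. If a part \<open>K\<close>
  of \<open>H\<close> misses the run \<open>R\<close> and is cut off by \<open>w\<close>, then \<open>w\<close> replaces all of \<open>R\<close> as an attachment of
  \<open>K\<close>, so the number of runs does not grow; for \<open>H - K\<close> the vertex \<open>w\<close> inherits the attachments of \<open>K\<close>.\<close>

lemma terminal_bound:
  fixes B :: "nat \<Rightarrow> 'a set" and \<rho> F :: "nat \<Rightarrow> nat"
  assumes "finite H" "finite I" "card (\<rho> ` I) < k"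
    and "\<And>K. K \<subseteq> H \<Longrightarrow> K \<noteq> {} \<Longrightarrow> k \<le> card (boundary H K) + card {i \<in> I. B i \<inter> K \<noteq> {}}"
    and "\<And>i j q. i \<in> I \<Longrightarrow> j \<in> I \<Longrightarrow> i \<noteq> j \<Longrightarrow> \<rho> i = \<rho> j \<Longrightarrow> is_path H q \<Longrightarrow>
      hd q \<in> B i \<Longrightarrow> last q \<in> B j \<Longrightarrow> length q \<le> F (\<rho> i) + 1"
    and "\<And>X. X \<subseteq> H \<Longrightarrow> X \<noteq> {} \<Longrightarrow> forces_long_path X"
  shows "edge_count H H + (\<Sum>i\<in>I. card (H \<inter> B i)) \<le> card H * ((\<Sum>R\<in>\<rho> ` I. F R) + card I)"
  using assms
proof (induction "card H" arbitrary: H I B rule: less_induct)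
  case less
  note [simp] = less.prems(1,2)
  note cond = less.prems(4) and jump = less.prems(5) and pb = less.prems(6)
  let ?F = "\<lambda>I. \<Sum>R\<in>\<rho> ` I. F R"
  show ?case
  proof (cases "H = {}")
    case True
    then show ?thesis by (simp add: edge_count_def)
  next
    case H_nonempty: False
    show ?thesis
    proof (cases "\<exists>K \<subset> H. K \<noteq> {} \<and> boundary H K = {}")
      case True
      \<comment> \<open>There are no edges between K and H - K, and both sides of the bound are
        additive, so the induction hypothesis for the two parts suffices.\<close>
      then obtain K where K: "K \<subset> H" "K \<noteq> {}" "boundary H K = {}" by blast
      define K' where "K' = H - K"
      have K': "K' \<subset> H" "K' \<noteq> {}" "boundary H K' = {}"
        using K sym by (auto simp: K'_def boundary_def)
      have part: "edge_count X X + (\<Sum>i\<in>I. card (X \<inter> B i)) \<le> card X * (?F I + card I)"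
        if X: "X \<subset> H" "boundary H X = {}" for X
      proof (rule less.hyps)
        show "card X < card H" using X by (simp add: psubset_card_mono)
        show "finite X" using X less.prems(1) finite_subset by blast
        show "k \<le> card (boundary X K) + card {i \<in> I. B i \<inter> K \<noteq> {}}" if "K \<subseteq> X" "K \<noteq> {}" for K
        proof -
          have "boundary X K = boundary H K" using X that by (auto simp: boundary_def)
          then show ?thesis using cond[of K] that X by auto
        qed
        show "length q \<le> F (\<rho> i) + 1"
          if "i \<in> I" "j \<in> I" "i \<noteq> j" "\<rho> i = \<rho> j" "is_path X q" "hd q \<in> B i" "last q \<in> B j" for i j q
          using jump[OF that(1-4) _ that(6,7)] is_path_mono[OF that(5)] X by auto
        show "forces_long_path Z" if "Z \<subseteq> X" "Z \<noteq> {}" for Z using pb that X by auto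
      qed (use less.prems in auto)
      have H: "H = K \<union> K'" "K \<inter> K' = {}" "finite K" "finite K'"
        using K(1) finite_subset[OF _ less.prems(1)] by (auto simp: K'_def)
      have "edge_count K K' = 0" using K H by (auto simp: edge_count_def boundary_def)
      then have "edge_count H H = edge_count K K + edge_count K' K'"
        using edge_count_Un[OF H(3,4,2)] H(1) by simp
      moreover have "card H = card K + card K'" using H card_Un_disjoint by metis
      moreover have "card (H \<inter> B i) = card (K \<inter> B i) + card (K' \<inter> B i)" for i
        using H by (subst card_Un_disjoint[symmetric]) (auto simp: Int_Un_distrib2)
      ultimately show ?thesis
        using part[OF K(1,3)] part[OF K'(1,3)] by (simp add: sum.distrib algebra_simps)
    next
      case False
      then have conn: "K = H" if "K \<subseteq> H" "K \<noteq> {}" "boundary H K = {}" for K using that by blast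
      \<comment> \<open>H has at least k attachments but fewer than k runs occur, so two attachments
        lie in a common run R.\<close>
      have "k \<le> card {i \<in> I. B i \<inter> H \<noteq> {}}"
        using cond[of H] H_nonempty by (simp add: boundary_def)
      moreover have "card (\<rho> ` {i \<in> I. B i \<inter> H \<noteq> {}}) \<le> card (\<rho> ` I)"
        by (intro card_mono) auto
      ultimately have "\<not> inj_on \<rho> {i \<in> I. B i \<inter> H \<noteq> {}}"
        using less.prems(3) by (intro pigeonhole) simp
      then obtain i0 j0 where ij: "i0 \<in> I" "j0 \<in> I" "i0 \<noteq> j0" "\<rho> i0 = \<rho> j0"
        "B i0 \<inter> H \<noteq> {}" "B j0 \<inter> H \<noteq> {}"
        unfolding inj_on_def by blast
      define R where "R = {i \<in> I. \<rho> i = \<rho> i0}"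
      have R: "R \<subseteq> I" "i0 \<in> R" "j0 \<in> R" "finite R" using ij by (auto simp: R_def)
      have card_R: "2 \<le> card R"
        using card_mono[of R "{i0, j0}"] R ij(3) by simp
      show ?thesis
      proof (cases "\<exists>K \<subseteq> H. K \<noteq> {} \<and> card (boundary H K) \<le> 1 \<and> K \<inter> (\<Union>i\<in>R. B i) = {}")
        case False
        \<comment> \<open>The run is merged into two terminals: \<open>i0\<close>, and all its other
          attachments together. A part of H with at most one boundary vertex meets the run by the
          case assumption, and H itself meets both terminals. This is what
          \<open>rooted_conn 2\<close> needs.\<close>
        define A where "A = (\<Union>i\<in>R - {i0}. B i)"
        have "rooted_conn 2 H (B i0) A"
          unfolding rooted_conn_def
        proof (intro allI impI disjI1)
          fix K assume K: "K \<subseteq> H" "K \<noteq> {}"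
          show "2 \<le> card (boundary H K) + of_bool (K \<inter> B i0 \<noteq> {}) + of_bool (K \<inter> A \<noteq> {})"
          proof (cases "boundary H K = {}")
            case True
            then have "K = H" using conn K by blast
            then have "K \<inter> B i0 \<noteq> {}" "K \<inter> A \<noteq> {}" using ij R by (auto simp: A_def)
            then show ?thesis by simp
          next
            case bd: False
            have "finite (boundary H K)" by (simp add: boundary_def)
            then have "card (boundary H K) \<noteq> 0" using bd by simp
            moreover have "(\<Union>i\<in>R. B i) = B i0 \<union> A" using R(2) by (auto simp: A_def)
            then have "K \<inter> B i0 \<noteq> {} \<or> K \<inter> A \<noteq> {}" if "card (boundary H K) \<le> 1"
              using False K that by (metis Int_Un_distrib Un_empty)
            ultimately show ?thesis by (cases "card (boundary H K) \<le> 1") auto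
          qed
        qed
        then obtain q where q: "is_path H q" "hd q \<in> B i0" "last q \<in> A"
          and len: "edge_count H H + card (H \<inter> B i0) + card (H \<inter> A) \<le> card H * (length q + 1)"
          using pb[of H] H_nonempty unfolding forces_long_path_def by blast
        from q(3) obtain j where j: "j \<in> R" "j \<noteq> i0" "last q \<in> B j" by (auto simp: A_def)
        \<comment> \<open>The ends of q are attached to \<open>i0\<close> and j of the same run, so
          \<open>jump\<close> applies. The factor \<open>?F I + 2\<close> pays for these two
          attachments; each other attachment has at most \<open>card H\<close> neighbours in H and
          is paid by its unit in \<open>card I\<close>.\<close>
        have "length q \<le> F (\<rho> i0) + 1"
          using jump[of i0 j q] ij(1) j q by (auto simp: R_def)
        moreover have "F (\<rho> i0) \<le> ?F I"
          using ij(1) by (intro member_le_sum) auto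
        ultimately have "card H * (length q + 1) \<le> card H * (?F I + 2)"
          by (intro mult_left_mono) auto
        moreover have "card (H \<inter> B j) \<le> card (H \<inter> A)"
          using j by (intro card_mono) (auto simp: A_def)
        moreover have "(\<Sum>i\<in>I. card (H \<inter> B i)) =
            card (H \<inter> B i0) + card (H \<inter> B j) + (\<Sum>i\<in>I - {i0, j}. card (H \<inter> B i))"
          using ij(1) j R(1) sum.remove[of I i0 "\<lambda>i. card (H \<inter> B i)"]
            sum.remove[of "I - {i0}" j "\<lambda>i. card (H \<inter> B i)"]
          by (auto simp: Diff_insert2[symmetric] insert_commute)
        moreover have "(\<Sum>i\<in>I - {i0, j}. card (H \<inter> B i)) \<le> card (I - {i0, j}) * card H"
          by (rule sum_bounded_above[where 'a = nat, simplified]) (auto intro: card_mono)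
        moreover have "card I = card (I - {i0, j}) + 2"
        proof -
          have "{i0, j} \<subseteq> I" using ij j R by auto
          then show ?thesis using card_mono[of I "{i0, j}"] j(2) by (simp add: card_Diff_subset)
        qed
        ultimately show ?thesis using len by (simp add: algebra_simps)
      next
        case True
        then obtain K where K: "K \<subseteq> H" "K \<noteq> {}" "card (boundary H K) \<le> 1"
          and K_R: "K \<inter> (\<Union>i\<in>R. B i) = {}" by blast
        have bd: "finite (boundary H K)" by (simp add: boundary_def)
        have "boundary H K \<noteq> {}"
          using conn[OF K(1,2)] K_R ij(5) R(2) by auto
        then have "card (boundary H K) = 1" using K(3) bd card_gt_0_iff[of "boundary H K"] by linarith
        then obtain w where w: "boundary H K = {w}" by (auto simp: card_1_singleton_iff)
        then have wHK: "w \<in> H" "w \<notin> K" by (auto simp: boundary_def)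
        have to_w: "v = w" if "u \<in> K" "E u v" "v \<in> H" "v \<notin> K" for u v
          using that w by (auto simp: boundary_def)
        have finK: "finite K" using K(1) finite_subset[OF _ less.prems(1)] by auto
        \<comment> \<open>The index \<open>i0\<close> is reused for the new attachment w of K. It is
          the only index of its run in \<open>IK\<close>, so the length condition for pairs in a
          common run never concerns w.\<close>
        define BK where "BK = B(i0 := {v. E v w})"
        define IK where "IK = insert i0 (I - R)"
        have IK: "IK \<subseteq> I" "finite IK" using ij(1) by (auto simp: IK_def)
        have K_part: "edge_count K K + (\<Sum>i\<in>IK. card (K \<inter> BK i)) \<le> card K * (?F IK + card IK)"
        proof (rule less.hyps)
          show "card K < card H" using K(1) wHK by (intro psubset_card_mono) auto
          show "card (\<rho> ` IK) < k"
            using card_mono[OF _ image_mono[OF IK(1)], of \<rho>] less.prems(3) by simp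
          show "k \<le> card (boundary K Z) + card {i \<in> IK. BK i \<inter> Z \<noteq> {}}"
            if Z: "Z \<subseteq> K" "Z \<noteq> {}" for Z
          proof -
            have "k \<le> card (boundary H Z) + card {i \<in> I. B i \<inter> Z \<noteq> {}}"
              using cond[of Z] Z K(1) by auto
            \<comment> \<open>No attachment of R meets Z. If w is a boundary vertex of Z, it is lost
              inside K but comes back as the attachment \<open>i0\<close>, so the total does not
              drop.\<close>
            moreover have sub: "{i \<in> I. B i \<inter> Z \<noteq> {}} \<subseteq> {i \<in> IK. BK i \<inter> Z \<noteq> {}} - {i0}"
              using K_R Z R(2) by (auto simp: IK_def BK_def)
            moreover have "boundary H Z \<subseteq> insert w (boundary K Z)"
              using Z to_w by (auto simp: boundary_def)
            moreover have "finite (boundary K Z)" using finK by (simp add: boundary_def)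
            moreover have "finite {i \<in> IK. BK i \<inter> Z \<noteq> {}}" using IK by simp
            ultimately show ?thesis
            proof (cases "w \<in> boundary H Z")
              case True
              then have "i0 \<in> {i \<in> IK. BK i \<inter> Z \<noteq> {}}"
                by (auto simp: boundary_def IK_def BK_def)
              then have "card {i \<in> I. B i \<inter> Z \<noteq> {}} + 1 \<le> card {i \<in> IK. BK i \<inter> Z \<noteq> {}}"
                using sub IK(2) card_mono[OF _ sub] card_Suc_Diff1[of "{i \<in> IK. BK i \<inter> Z \<noteq> {}}" i0]
                by simp
              moreover have "card (boundary H Z) \<le> card (boundary K Z) + 1"
                using card_mono[OF _ \<open>boundary H Z \<subseteq> insert w (boundary K Z)\<close>]
                  \<open>finite (boundary K Z)\<close> by (simp add: card_insert_if split: if_splits)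
              ultimately show ?thesis
                using \<open>k \<le> card (boundary H Z) + card {i \<in> I. B i \<inter> Z \<noteq> {}}\<close> by linarith
            next
              case False
              then have "card (boundary H Z) \<le> card (boundary K Z)"
                using \<open>boundary H Z \<subseteq> insert w (boundary K Z)\<close> \<open>finite (boundary K Z)\<close>
                by (intro card_mono) auto
              moreover have "card {i \<in> I. B i \<inter> Z \<noteq> {}} \<le> card {i \<in> IK. BK i \<inter> Z \<noteq> {}}"
                using sub IK(2) by (intro card_mono) auto
              ultimately show ?thesis
                using \<open>k \<le> card (boundary H Z) + card {i \<in> I. B i \<inter> Z \<noteq> {}}\<close> by linarith
            qed
          qed
          show "length q \<le> F (\<rho> i) + 1"
            if "i \<in> IK" "j \<in> IK" "i \<noteq> j" "\<rho> i = \<rho> j" "is_path K q" "hd q \<in> BK i" "last q \<in> BK j"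
            for i j q
          proof -
            have "i \<noteq> i0" "j \<noteq> i0" using that(1-4) by (auto simp: IK_def R_def)
            then show ?thesis
              using jump[of i j q] that is_path_mono[OF that(5) K(1)] IK(1) by (auto simp: BK_def)
          qed
          show "forces_long_path Z" if "Z \<subseteq> K" "Z \<noteq> {}" for Z using pb that K(1) by auto
        qed (use finK IK in auto)

        define D where "D = H - K"
        have D: "finite D" "D \<noteq> {}" "D \<subseteq> H" "w \<in> D" using wHK by (auto simp: D_def)
        define BD where "BD i = (B i - K) \<union> (if B i \<inter> K \<noteq> {} then {w} else {})" for i
        \<comment> \<open>Such an r prolongs a path of D ending at w to a path of H ending in
          \<open>B i\<close>. Prolonging only increases the length, so the bound of
          \<open>jump\<close> passes to \<open>BD\<close>.\<close>
        have to_w_path: "\<exists>r. is_path K r \<and> hd r \<in> B i \<and> E (last r) w" if "B i \<inter> K \<noteq> {}" for i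
        proof -
          define Z where "Z = reach K (B i)"
          have Z: "Z \<subseteq> K" "boundary K Z = {}" "Z \<noteq> {}"
            using reach_subset boundary_reach subset_reach[of "B i" K] that by (auto simp: Z_def)
          then have "boundary H Z \<noteq> {}" using conn[of Z] K(1) wHK by auto
          then obtain u v where "u \<in> Z" "E u v" "v \<in> H" "v \<notin> Z" by (auto simp: boundary_def)
          then have "u \<in> Z" "E u w" using Z to_w[of u v] by (auto simp: boundary_def)
          then show ?thesis unfolding Z_def reach_def by blast
        qed
        have D_part: "edge_count D D + (\<Sum>i\<in>I. card (D \<inter> BD i)) \<le> card D * (?F I + card I)"
        proof (rule less.hyps)
          show "card D < card H" using K by (intro psubset_card_mono) (auto simp: D_def)
          show "k \<le> card (boundary D Z) + card {i \<in> I. BD i \<inter> Z \<noteq> {}}" if Z: "Z \<subseteq> D" "Z \<noteq> {}" for Z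
          proof -
            \<comment> \<open>The set to compare with is \<open>Z \<union> K\<close> if w is in Z,
              and Z itself otherwise.\<close>
            have *: ?thesis
              if "Z' \<subseteq> H" "Z' \<noteq> {}" "boundary H Z' \<subseteq> boundary D Z"
                "\<And>i. B i \<inter> Z' \<noteq> {} \<Longrightarrow> BD i \<inter> Z \<noteq> {}" for Z'
            proof -
              have "card (boundary H Z') \<le> card (boundary D Z)"
                using that(3) D(1) by (intro card_mono) (auto simp: boundary_def)
              moreover have "card {i \<in> I. B i \<inter> Z' \<noteq> {}} \<le> card {i \<in> I. BD i \<inter> Z \<noteq> {}}"
                using that(4) by (intro card_mono) auto
              ultimately show ?thesis using cond[OF that(1,2)] by linarith
            qed
            show ?thesis
            proof (cases "w \<in> Z")
              case True
              show ?thesis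
              proof (rule *[of "Z \<union> K"])
                show "boundary H (Z \<union> K) \<subseteq> boundary D Z"
                  using True to_w by (auto simp: boundary_def D_def)
              qed (use Z True K D(3) in \<open>auto simp: BD_def D_def split: if_splits\<close>)
            next
              case False
              show ?thesis
              proof (rule *[of Z])
                show "boundary H Z \<subseteq> boundary D Z"
                proof
                  fix v assume "v \<in> boundary H Z"
                  then obtain u where u: "u \<in> Z" "E u v" "v \<in> H" "v \<notin> Z" by (auto simp: boundary_def)
                  then have "v \<notin> K" using to_w[of v u] sym[of u v] Z(1) False by (auto simp: D_def)
                  then show "v \<in> boundary D Z" using u by (auto simp: boundary_def D_def)
                qed
                show "BD i \<inter> Z \<noteq> {}" if "B i \<inter> Z \<noteq> {}" for i
                  using that Z(1) by (auto simp: BD_def D_def)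
              qed (use Z D(3) in auto)
            qed
          qed
          show "length q \<le> F (\<rho> i) + 1"
            if ijq: "i \<in> I" "j \<in> I" "i \<noteq> j" "\<rho> i = \<rho> j"
              and q: "is_path D q" "hd q \<in> BD i" "last q \<in> BD j" for i j q
          proof -
            have qH: "is_path H q" "q \<noteq> []" "set q \<inter> K = {}" "distinct q"
              using is_path_mono[OF q(1) D(3)] q(1) by (auto simp: is_path_def D_def)
            consider "hd q \<in> B i" "last q \<in> B j"
              | "hd q = w" "last q = w"
              | "hd q = w" "B i \<inter> K \<noteq> {}" "last q \<in> B j"
              | "hd q \<in> B i" "last q = w" "B j \<inter> K \<noteq> {}"
              using q(2,3) by (auto simp: BD_def split: if_splits)
            then show ?thesis
            proof cases
              case 1
              then show ?thesis using jump[OF ijq qH(1)] by simp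
            next
              case 2
              then have "length q = 1" using qH(2,4)
                by (cases q) (auto split: if_splits dest: last_in_set)
              then show ?thesis by simp
            next
              case 3
              then obtain r where r: "is_path K r" "hd r \<in> B i" "E (last r) w"
                using to_w_path by blast
              have r': "is_path H r" "r \<noteq> []" "set r \<subseteq> K"
                using is_path_mono[OF r(1) K(1)] r(1) by (auto simp: is_path_def)
              then have "is_path H (r @ q)" using r qH 3 by (auto simp: is_path_append)
              then show ?thesis using jump[OF ijq, of "r @ q"] r r' qH 3 by simp
            next
              case 4
              then obtain r where r: "is_path K r" "hd r \<in> B j" "E (last r) w"
                using to_w_path by blast
              have r': "is_path H (rev r)" "r \<noteq> []" "set r \<subseteq> K"
                using is_path_mono[OF r(1) K(1)] r(1) is_path_rev by (auto simp: is_path_def)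
              then have "is_path H (q @ rev r)"
                using r qH 4 sym[of "last r" w] by (auto simp: is_path_append hd_rev)
              then show ?thesis using jump[OF ijq, of "q @ rev r"] r r' qH 4 by (simp add: last_rev)
            qed
          qed
          show "forces_long_path Z" if "Z \<subseteq> D" "Z \<noteq> {}" for Z using pb that D(3) by auto
        qed (use D(1) less.prems in auto)

        have H: "H = K \<union> D" "K \<inter> D = {}" using K(1) by (auto simp: D_def)
        \<comment> \<open>All edges between K and D go to w, and they contribute 2 e. The bound for
          K already counts e once, through the attachment w.\<close>
        define e where "e = card (K \<inter> {v. E v w})"
        have e_le: "e \<le> card K" unfolding e_def using finK by (intro card_mono) auto
        have "edge_count K D = edge_count K {w}"
          unfolding edge_count_def
        proof (intro sum.cong refl arg_cong[where f = card])
          fix v assume "v \<in> K"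
          then show "{u \<in> D. E v u} = {u \<in> {w}. E v u}" using to_w[of v] D by (auto simp: D_def)
        qed
        also have "\<dots> = edge_count {w} K" using finK by (simp add: edge_count_sym)
        also have "\<dots> = e"
          unfolding edge_count_def e_def
          by (simp, intro arg_cong[where f = card]) (auto intro: sym)
        finally have edges: "edge_count H H = edge_count K K + edge_count D D + 2 * e"
          using edge_count_Un[OF finK D(1) H(2)] H(1) by simp
        have cards: "card H = card K + card D" using H finK D(1) card_Un_disjoint by metis
        have "card (H \<inter> B i) \<le> card (K \<inter> B i) + card (D \<inter> BD i)" for i
        proof -
          have "card (H \<inter> B i) = card (K \<inter> B i) + card (D \<inter> B i)"
            using H finK D(1) by (subst card_Un_disjoint[symmetric]) (auto simp: Int_Un_distrib2)
          moreover have "card (D \<inter> B i) \<le> card (D \<inter> BD i)"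
            using D(1) by (intro card_mono) (auto simp: BD_def D_def)
          ultimately show ?thesis by simp
        qed
        then have "(\<Sum>i\<in>I. card (H \<inter> B i)) \<le> (\<Sum>i\<in>I. card (K \<inter> B i) + card (D \<inter> BD i))"
          by (intro sum_mono) auto
        also have "\<dots> = (\<Sum>i\<in>I. card (K \<inter> B i)) + (\<Sum>i\<in>I. card (D \<inter> BD i))"
          by (simp add: sum.distrib)
        also have "(\<Sum>i\<in>I. card (K \<inter> B i)) = (\<Sum>i\<in>I - R. card (K \<inter> B i))"
        proof (intro sum.mono_neutral_right ballI)
          fix i assume "i \<in> I - (I - R)"
          then have "K \<inter> B i = {}" using K_R by blast
          then show "card (K \<inter> B i) = 0" by simp
        qed auto
        finally have sums: "(\<Sum>i\<in>I. card (H \<inter> B i)) \<le>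
            (\<Sum>i\<in>I - R. card (K \<inter> B i)) + (\<Sum>i\<in>I. card (D \<inter> BD i))" .
        have "(\<Sum>i\<in>IK. card (K \<inter> BK i)) = e + (\<Sum>i\<in>I - R. card (K \<inter> BK i))"
          using R by (simp add: IK_def BK_def e_def)
        also have "(\<Sum>i\<in>I - R. card (K \<inter> BK i)) = (\<Sum>i\<in>I - R. card (K \<inter> B i))"
          using R by (intro sum.cong) (auto simp: BK_def)
        finally have sumK: "(\<Sum>i\<in>IK. card (K \<inter> BK i)) = e + (\<Sum>i\<in>I - R. card (K \<inter> B i))" .
        \<comment> \<open>At least two attachments of R were replaced by one. The spare unit,
          multiplied by \<open>card K\<close>, pays for the second e.\<close>
        have "card IK + 1 \<le> card I"
          using R card_R card_mono[OF less.prems(2) R(1)] by (simp add: IK_def card_Diff_subset)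
        moreover have "?F IK \<le> ?F I" using IK by (intro sum_mono2) auto
        ultimately have "?F IK + card IK + 1 \<le> ?F I + card I" by linarith
        then have "card K * (?F IK + card IK + 1) \<le> card K * (?F I + card I)"
          by (rule mult_left_mono) simp
        then have "card K * (?F IK + card IK) + card K \<le> card K * (?F I + card I)"
          by (simp add: algebra_simps)
        moreover have "card H * (?F I + card I) = card K * (?F I + card I) + card D * (?F I + card I)"
          unfolding cards by (rule add_mult_distrib)
        ultimately show ?thesis
          using K_part D_part edges sums sumK e_le by linarith
      qed
    qed
  qed
qed

section \<open>Detours through one component off a path\<close>

text \<open>A path of H from a to a vertex of q is cut at its first vertex on q.\<close>

lemma connected_tail:
  assumes conn: "\<And>K. K \<subseteq> H \<Longrightarrow> K \<noteq> {} \<Longrightarrow> boundary H K = {} \<Longrightarrow> K = H"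
    and a: "a \<in> H" and q: "is_path H q"
  obtains r c where "is_path H (r @ [c])" "hd (r @ [c]) = a" "c \<in> set q" "set r \<inter> set q = {}"
proof -
  have "reach H {a} = H"
    using conn[OF reach_subset, of "{a}"] boundary_reach subset_reach[of "{a}" H] a by auto
  then have "hd q \<in> reach H {a}" using q is_path_hd_last by blast
  then obtain s where s: "is_path H s" "hd s = a" "last s = hd q"
    by (auto simp: reach_def)
  have "\<exists>x\<in>set s. x \<in> set q" using s q by (metis is_path_def last_in_set list.set_sel(1))
  then obtain r c t where rct: "s = r @ c # t" "c \<in> set q" "\<forall>x\<in>set r. x \<notin> set q"
    using split_list_first_prop[of s "\<lambda>x. x \<in> set q"] by blast
  have "s = (r @ [c]) @ t" using rct by simp
  then have "is_path H (r @ [c])" "hd (r @ [c]) = a"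
    using s by (auto simp: is_path_def successively_append_iff hd_append)
  then show ?thesis using that rct by blast
qed

text \<open>Here \<open>B i\<close> is the set of neighbours in \<open>H\<close> of the \<open>i\<close>-th vertex of a path, \<open>Y\<close> is a set of
  positions on the path, and \<open>detour\<close> is what maximality of the path yields.\<close>

lemma component_bound:
  fixes B :: "nat \<Rightarrow> 'a set"
  assumes fin: "finite H" and ne: "H \<noteq> {}" and Y: "finite Y" "card Y + 2 \<le> k"
    and conn: "\<And>K. K \<subseteq> H \<Longrightarrow> K \<noteq> {} \<Longrightarrow> boundary H K = {} \<Longrightarrow> K = H"
    and cond: "\<And>K. K \<subseteq> H \<Longrightarrow> K \<noteq> {} \<Longrightarrow> k \<le> card (boundary H K) + card {i. i \<le> L \<and> B i \<inter> K \<noteq> {}}"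
    and detour: "\<And>i j q. i < j \<Longrightarrow> j \<le> L \<Longrightarrow> {i<..<j} \<inter> Y = {} \<Longrightarrow> is_path H q \<Longrightarrow>
      hd q \<in> B i \<Longrightarrow> last q \<in> B j \<Longrightarrow> i + length q + 1 \<le> j"
    and pb: "\<And>X. X \<subseteq> H \<Longrightarrow> X \<noteq> {} \<Longrightarrow> forces_long_path X"
  shows "edge_count H H + (\<Sum>i<L. card (H \<inter> B i) + card (H \<inter> B (Suc i))) \<le> L * card H"
proof -
  define I where "I = {i. i \<le> L \<and> B i \<inter> H \<noteq> {}}"
  \<comment> \<open>Between consecutive attachments i and j with \<open>i + 2 \<le> j\<close> there
    are j - i - 2 elements of J, one less than the length that \<open>detour\<close> allows for
    q.\<close>
  define J where "J = {t. t \<notin> I \<and> Suc t \<notin> I}"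
  \<comment> \<open>The number of the run: between consecutive attachments it grows exactly when a
    position of Y lies strictly between them. Positions of Y that are attachments themselves
    interrupt nothing.\<close>
  define \<rho> where "\<rho> t = card {y \<in> Y - I. y < t}" for t
  define F where "F R = card {t. t < L \<and> t \<in> J \<and> \<rho> t = R}" for R
  have I_le: "i \<le> L" if "i \<in> I" for i using that by (simp add: I_def)
  have finI: "finite I" by (simp add: I_def)
  have \<rho>_mono: "\<rho> s \<le> \<rho> t" if "s \<le> t" for s t
    unfolding \<rho>_def using Y(1) that by (intro card_mono) auto
  have long_detour: "length q \<le> 1 + card {t \<in> J. i < t \<and> t < j}"
    if "i < j" "i \<in> I" "j \<in> I" "\<rho> i = \<rho> j" "is_path H q" "hd q \<in> B i" "last q \<in> B j" for i j q
    using that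
  proof (induction "j - i" arbitrary: i j q rule: less_induct)
    case less
    note prems = less.prems
    show ?case
    proof (cases "\<exists>t\<in>I. i < t \<and> t < j")
      case False
      have "{i<..<j} \<inter> Y = {}"
      proof (rule ccontr)
        assume "{i<..<j} \<inter> Y \<noteq> {}"
        then obtain y where y: "y \<in> Y" "i < y" "y < j" by auto
        then have "y \<in> {y \<in> Y - I. y < j} - {y \<in> Y - I. y < i}" using False by auto
        moreover have "{y \<in> Y - I. y < i} \<subseteq> {y \<in> Y - I. y < j}" using prems(1) by auto
        ultimately have "{y \<in> Y - I. y < i} \<subset> {y \<in> Y - I. y < j}" by blast
        then have "\<rho> i < \<rho> j" unfolding \<rho>_def using Y(1) by (intro psubset_card_mono) auto
        then show False using prems(4) by simp
      qed
      then have "i + length q + 1 \<le> j" using detour prems I_le by blast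
      moreover have "{t \<in> J. i < t \<and> t < j} = {i<..<j - 1}"
        using False prems(1,3) by (auto simp: J_def less_diff_conv) (metis Suc_lessI less_SucI lessI)
      ultimately show ?thesis by simp
    next
      case True
      then obtain t where t: "t \<in> I" "i < t" "t < j" by blast
      then obtain a where a: "a \<in> B t" "a \<in> H" by (auto simp: I_def)
      \<comment> \<open>Cutting \<open>q\<close> at \<open>c\<close> and joining both parts to \<open>B t\<close> along \<open>r\<close> gives two paths with together more
        vertices than \<open>q\<close>, one for each side of \<open>t\<close>.\<close>
      obtain r c where r: "is_path H (r @ [c])" "hd (r @ [c]) = a" "c \<in> set q" "set r \<inter> set q = {}"
        using connected_tail[OF conn a(2) prems(5)] by blast
      obtain q1 q2 where q: "q = q1 @ c # q2" using r(3) split_list by fast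
      have "is_path H (q1 @ [c] @ rev r)"
      proof -
        have "is_path H (rev (r @ [c]))" using r(1) is_path_rev by blast
        then have "is_path H (c # rev r)" by simp
        moreover have "is_path H (q1 @ [c])" using prems(5) q
          by (auto simp: is_path_def successively_append_iff)
        ultimately show ?thesis using r(4) q
          by (cases "q1 = []") (auto simp: is_path_append)
      qed
      moreover have "hd (q1 @ [c] @ rev r) = hd q" "last (q1 @ [c] @ rev r) = a"
        using q r(2) by (cases q1; cases r; auto)+
      ultimately have 1: "length q1 + 1 + length r \<le> 1 + card {s \<in> J. i < s \<and> s < t}"
        using less.hyps[of t i "q1 @ [c] @ rev r"] t prems a \<rho>_mono[of i t] \<rho>_mono[of t j] by simp
      have "is_path H ((r @ [c]) @ q2)"
      proof (cases "q2 = []")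
        case False
        have "is_path H q2" "E c (hd q2)" "c \<notin> set q2"
          using prems(5) False unfolding q by (auto simp: is_path_def successively_append_iff successively_Cons)
        then show ?thesis using r q False by (subst is_path_append) auto
      qed (use r in simp)
      moreover have "hd ((r @ [c]) @ q2) = a" "last ((r @ [c]) @ q2) = last q"
        using q r(2) by (auto simp: hd_append)
      ultimately have 2: "length r + 1 + length q2 \<le> 1 + card {s \<in> J. t < s \<and> s < j}"
        using less.hyps[of j t "(r @ [c]) @ q2"] t prems a \<rho>_mono[of i t] \<rho>_mono[of t j] by simp
      have "card {s \<in> J. i < s \<and> s < t} + card {s \<in> J. t < s \<and> s < j}
          = card ({s \<in> J. i < s \<and> s < t} \<union> {s \<in> J. t < s \<and> s < j})"
        by (subst card_Un_disjoint) auto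
      also have "\<dots> \<le> card {s \<in> J. i < s \<and> s < j}"
        using t by (intro card_mono) auto
      finally show ?thesis using 1 2 q by simp
    qed
  qed
  have detour_F: "length q \<le> F (\<rho> i) + 1"
    if ij: "i < j" "i \<in> I" "j \<in> I" "\<rho> i = \<rho> j" and q: "is_path H q" "hd q \<in> B i" "last q \<in> B j" for i j q
  proof -
    have "\<rho> t = \<rho> i" if "i < t" "t < j" for t
      using \<rho>_mono[of i t] \<rho>_mono[of t j] that ij(4) by simp
    then have "card {t \<in> J. i < t \<and> t < j} \<le> F (\<rho> i)"
      unfolding F_def using I_le[OF ij(3)] by (intro card_mono) auto
    then show ?thesis using long_detour[OF that] by simp
  qed
  \<comment> \<open>So there are at most \<open>card Y + 1\<close> runs, which is less than
    k.\<close>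
  have sub: "\<rho> ` I \<subseteq> {..card Y}"
    unfolding \<rho>_def using Y(1) by (auto intro!: card_mono)
  have "edge_count H H + (\<Sum>i\<in>I. card (H \<inter> B i)) \<le> card H * ((\<Sum>R\<in>\<rho> ` I. F R) + card I)"
  proof (rule terminal_bound[OF fin finI, where k = k])
    show "card (\<rho> ` I) < k" using card_mono[OF _ sub] Y(2) by simp
    show "k \<le> card (boundary H K) + card {i \<in> I. B i \<inter> K \<noteq> {}}" if "K \<subseteq> H" "K \<noteq> {}" for K
    proof -
      have "{i. i \<le> L \<and> B i \<inter> K \<noteq> {}} = {i \<in> I. B i \<inter> K \<noteq> {}}" using that by (auto simp: I_def)
      then show ?thesis using cond[OF that] by simp
    qed
    show "length q \<le> F (\<rho> i) + 1" if "i \<in> I" "j \<in> I" "i \<noteq> j" "\<rho> i = \<rho> j"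
      "is_path H q" "hd q \<in> B i" "last q \<in> B j" for i j q
    proof (cases "i < j")
      case False
      have "q \<noteq> []" using that by (simp add: is_path_def)
      then show ?thesis
        using detour_F[of j i "rev q"] that False by (simp add: is_path_rev hd_rev last_rev)
    qed (use detour_F that in blast)
  qed (use pb in auto)
  also have "(\<Sum>R\<in>\<rho> ` I. F R) \<le> card {t. t < L \<and> t \<in> J}"
  proof -
    have "(\<Sum>R\<in>\<rho> ` I. F R) = card (\<Union>R\<in>\<rho> ` I. {t. t < L \<and> t \<in> J \<and> \<rho> t = R})"
      unfolding F_def using finI by (intro card_UN_disjoint[symmetric]) auto
    also have "\<dots> \<le> card {t. t < L \<and> t \<in> J}" by (intro card_mono) auto
    finally show ?thesis .
  qed
  finally have main: "edge_count H H + (\<Sum>i\<in>I. card (H \<inter> B i)) \<le>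
      card H * (card {t. t < L \<and> t \<in> J} + card I)" by simp
  \<comment> \<open>The edge of the path from t to t + 1 is classified by its attached end: I1 if t
    is an attachment, I2 if t + 1 is, J if neither. Both cannot be, since \<open>detour\<close>
    would give a path with no vertex. Hence the three sizes add up to at most L.\<close>
  define I1 where "I1 = {t. t < L \<and> t \<in> I}"
  define I2 where "I2 = {t. t < L \<and> Suc t \<in> I}"
  have disj: "I1 \<inter> I2 = {}"
  proof (rule ccontr)
    assume "I1 \<inter> I2 \<noteq> {}"
    then obtain t where t: "t \<in> I" "Suc t \<in> I" "t < L" by (auto simp: I1_def I2_def)
    then obtain a b where ab: "a \<in> B t" "a \<in> H" "b \<in> B (Suc t)" "b \<in> H" by (auto simp: I_def)
    have "reach H {a} = H"
      using conn[OF reach_subset, of "{a}"] boundary_reach subset_reach[of "{a}" H] ab by auto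
    then have "b \<in> reach H {a}" using ab(4) by simp
    then obtain q where "is_path H q" "hd q = a" "last q = b" by (auto simp: reach_def)
    moreover have "{t<..<Suc t} = {}" by auto
    ultimately show False using detour[of t "Suc t" q] t ab is_path_length_pos[of H q] by auto
  qed
  have fin12: "finite I1" "finite I2" by (auto simp: I1_def I2_def)
  have "card {t. t < L \<and> t \<in> J} + card I1 + card I2 = card ({t. t < L \<and> t \<in> J} \<union> I1 \<union> I2)"
    using disj fin12 by (subst card_Un_disjoint; (subst card_Un_disjoint)?) (auto simp: J_def I1_def I2_def)
  also have "\<dots> \<le> card {..<L}" by (intro card_mono) (auto simp: I1_def I2_def)
  finally have count: "card {t. t < L \<and> t \<in> J} + card I1 + card I2 \<le> L" by simp

  define b where "b i = card (H \<inter> B i)" for i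
  have b_le: "b i \<le> card H" for i unfolding b_def using fin by (intro card_mono) auto
  have b0: "b i = 0" if "i \<le> L" "i \<notin> I" for i
    using that by (auto simp: b_def I_def Int_commute)
  have b1: "(\<Sum>i<L. b i) = (\<Sum>i\<in>I1. b i)"
    by (intro sum.mono_neutral_right) (auto simp: I1_def b0)
  have b2: "(\<Sum>i<L. b (Suc i)) = (\<Sum>i\<in>I2. b (Suc i))"
    by (intro sum.mono_neutral_right) (auto simp: I2_def b0)
  have sumI: "(\<Sum>i\<in>I. b i) = (\<Sum>i\<in>{..L}. b i)"
    by (intro sum.mono_neutral_left) (auto simp: I_def b0)
  have I_card: "card I = card I1 + (if L \<in> I then 1 else 0)"
  proof -
    have "L \<notin> I1" by (simp add: I1_def)
    moreover have "card I = card (if L \<in> I then insert L I1 else I1)"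
      using I_le by (intro arg_cong[where f = card]) (auto simp: I1_def le_less)
    ultimately show ?thesis using fin12 by simp
  qed
  have "L \<noteq> 0"
  proof
    assume "L = 0"
    then have "card {i. i \<le> L \<and> B i \<inter> H \<noteq> {}} \<le> card {0::nat}" by (intro card_mono) auto
    then show False using cond[of H] ne Y(2) by (simp add: boundary_def)
  qed
  \<comment> \<open>The sum over \<open>i < L\<close> counts inner positions twice and the ends 0
    and L once. \<open>main\<close> covers every attachment once; I3 indexes the second occurrences
    of the inner ones. In total \<open>card I + card I3 = card I1 + card I2\<close>.\<close>
  define I3 where "I3 = {t. t < L \<and> Suc t \<in> I \<and> Suc t \<noteq> L}"
  have I2_card: "card I2 = card I3 + (if L \<in> I then 1 else 0)"
  proof -
    have "L - 1 \<notin> I3" "finite I3" using \<open>L \<noteq> 0\<close> by (auto simp: I3_def)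
    moreover have "card I2 = card (if L \<in> I then insert (L - 1) I3 else I3)"
      using \<open>L \<noteq> 0\<close> by (intro arg_cong[where f = card]) (auto simp: I2_def I3_def)
    ultimately show ?thesis by simp
  qed
  obtain m where m: "L = Suc m" using \<open>L \<noteq> 0\<close> not0_implies_Suc by blast
  have "(\<Sum>i<L. b i + b (Suc i)) = (\<Sum>i\<in>I. b i) + (\<Sum>i<m. b (Suc i))"
  proof -
    have "(\<Sum>i\<in>I. b i) = (\<Sum>i<L. b i) + b L" by (simp add: sumI lessThan_Suc_atMost[symmetric])
    moreover have "(\<Sum>i<L. b (Suc i)) = (\<Sum>i<m. b (Suc i)) + b L" by (simp add: m)
    ultimately show ?thesis by (simp add: sum.distrib)
  qed
  also have "(\<Sum>i<m. b (Suc i)) = (\<Sum>i\<in>I3. b (Suc i))"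
  proof (intro sum.mono_neutral_right ballI)
    fix i assume "i \<in> {..<m} - I3"
    then have "Suc i \<le> L" "Suc i \<notin> I" by (auto simp: I3_def m)
    then show "b (Suc i) = 0" by (rule b0)
  qed (auto simp: I3_def m)
  also have "\<dots> \<le> card I3 * card H"
    using sum_bounded_above[of I3 "\<lambda>i. b (Suc i)" "card H"] b_le by simp
  finally have "edge_count H H + (\<Sum>i<L. b i + b (Suc i)) \<le>
      card H * (card {t. t < L \<and> t \<in> J} + card I + card I3)"
    using main by (simp add: b_def algebra_simps)
  also have "\<dots> \<le> card H * L"
    using count I_card I2_card by (intro mult_left_mono) auto
  finally show ?thesis by (simp add: b_def mult.commute)
qed

section \<open>From components to the degree sum\<close>

text \<open>The bound for single components is summed over the components of W - p. As
  \<open>forces_long_path\<close> is assumed for proper subsets only, the lemma can also serve in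
  the induction that establishes it.\<close>

lemma degree_sum_path_bound:
  assumes W: "finite W" and k: "2 \<le> k" and conn: "rooted_conn k W A C"
    and Y: "card Y + 2 \<le> k" "Y \<subseteq> set p"
    and p: "is_path W p" "hd p \<in> A" "last p \<in> C" "k \<le> length p + 2"
    and longest: "\<And>q. is_path W q \<Longrightarrow> hd q \<in> A \<Longrightarrow> last q \<in> C \<Longrightarrow> Y \<subseteq> set q \<Longrightarrow> length q \<le> length p"
    and pb: "\<And>X. X \<subset> W \<Longrightarrow> X \<noteq> {} \<Longrightarrow> forces_long_path X"
  shows "edge_count W W + card (W \<inter> A) + card (W \<inter> C) \<le> card W * (length p + 1)"
proof -
  define n where "n = length p"
  \<comment> \<open>Positions 0 and \<open>Suc n\<close> stand for the ends x and z outside W, so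
    the vertices of p are shifted by one and the whole path has L = \<open>Suc n\<close>
    edges.\<close>
  define B where "B i = (if i = 0 then A else if i = Suc n then C else {v. E (p ! (i - 1)) v})" for i
  define X where "X = W - set p"
  define Y' where "Y' = {i. 0 < i \<and> i \<le> n \<and> p ! (i - 1) \<in> Y}"
  have p': "p \<noteq> []" "distinct p" "set p \<subseteq> W" "successively E p" "0 < n"
    using p(1) by (auto simp: is_path_def n_def)
  have finX: "finite X" and finp: "finite (set p)" using W by (auto simp: X_def)
  have WX: "W = set p \<union> X" "set p \<inter> X = {}" using p' by (auto simp: X_def)
  have "card Y' \<le> card Y"
  proof (rule card_inj_on_le)
    show "inj_on (\<lambda>i. p ! (i - 1)) Y'"
      using p'(2) by (auto simp: inj_on_def Y'_def n_def nth_eq_iff_index_eq)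
    show "finite Y" using Y(2) finite_subset by blast
  qed (auto simp: Y'_def)
  then have Y': "finite Y'" "card Y' + 2 \<le> k" using Y(1) by (auto simp: Y'_def)
  have count: "k \<le> card (boundary X K) + card {i. i \<le> Suc n \<and> B i \<inter> K \<noteq> {}}" if K: "K \<subseteq> X" "K \<noteq> {}" for K
  proof -
    define Q where "Q = {i. i < n \<and> p ! i \<in> boundary W K}"
    have att: "{i. i \<le> Suc n \<and> B i \<inter> K \<noteq> {}} =
      Suc ` Q \<union> (if K \<inter> A \<noteq> {} then {0} else {}) \<union> (if K \<inter> C \<noteq> {} then {Suc n} else {})" (is "?S = ?T")
    proof -
      have "i \<in> ?S \<longleftrightarrow> i \<in> ?T" for i
      proof -
        consider "i = 0" | "i = Suc n" | j where "i = Suc j" "j < n" | "i > Suc n"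
          by (metis less_Suc_eq linorder_neqE_nat not0_implies_Suc)
        then show ?thesis
        proof cases
          case (3 j)
          then have "p ! j \<in> set p" by (simp add: n_def)
          then have "p ! j \<in> W" "p ! j \<notin> K" using K WX by auto
          then have "p ! j \<in> boundary W K \<longleftrightarrow> (\<exists>v\<in>K. E (p ! j) v)"
            by (auto simp: boundary_def intro: sym)
          then show ?thesis using 3 by (auto simp: B_def Q_def)
        qed (auto simp: B_def Q_def)
      qed
      then show ?thesis by blast
    qed
    have "finite Q" by (simp add: Q_def)
    then have card_att: "card {i. i \<le> Suc n \<and> B i \<inter> K \<noteq> {}} =
        card Q + of_bool (K \<inter> A \<noteq> {}) + of_bool (K \<inter> C \<noteq> {})"
      unfolding att using p'(5) by (auto simp: card_insert_if card_image Q_def)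
    have img: "(!) p ` Q = boundary W K \<inter> set p"
      by (auto simp: Q_def n_def in_set_conv_nth)
    have "inj_on ((!) p) Q" using p'(2) by (auto simp: inj_on_def Q_def n_def nth_eq_iff_index_eq)
    then have Q: "card Q = card (boundary W K \<inter> set p)" using img card_image by metis
    have "boundary W K = boundary X K \<union> (boundary W K \<inter> set p)"
      using K by (auto simp: boundary_def X_def)
    then have "card (boundary W K) \<le> card (boundary X K) + card Q"
      unfolding Q by (metis card_Un_le)
    \<comment> \<open>This serves the second alternative of \<open>rooted_conn\<close>: K is then
      attached to all n vertices of p and to both ends, and \<open>n + 2\<close> is at least k by
      assumption.\<close>
    have "n \<le> card Q" if "K \<union> boundary W K = W"
    proof -
      have "set p \<subseteq> boundary W K \<inter> set p" using that K WX by auto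
      then have "card (set p) \<le> card Q" unfolding Q by (intro card_mono) auto
      then show ?thesis using p'(2) by (simp add: n_def distinct_card)
    qed
    have "K \<subseteq> W" using K WX by auto
    then have "k \<le> card (boundary W K) + of_bool (K \<inter> A \<noteq> {}) + of_bool (K \<inter> C \<noteq> {}) \<or>
      K \<union> boundary W K = W \<and> K \<inter> A \<noteq> {} \<and> K \<inter> C \<noteq> {}"
      using conn K(2) by (simp add: rooted_conn_def)
    then show ?thesis
    proof
      assume "k \<le> card (boundary W K) + of_bool (K \<inter> A \<noteq> {}) + of_bool (K \<inter> C \<noteq> {})"
      then show ?thesis
        unfolding card_att using \<open>card (boundary W K) \<le> card (boundary X K) + card Q\<close> by linarith
    next
      assume "K \<union> boundary W K = W \<and> K \<inter> A \<noteq> {} \<and> K \<inter> C \<noteq> {}"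
      then show ?thesis
        unfolding card_att using \<open>K \<union> boundary W K = W \<Longrightarrow> n \<le> card Q\<close> p(4)
        by (simp add: n_def[symmetric])
    qed
  qed
  have detour: "i + length q + 1 \<le> j"
    if ij: "i < j" "j \<le> Suc n" "{i<..<j} \<inter> Y' = {}" and q: "is_path X q" "hd q \<in> B i" "last q \<in> B j" for i j q
  proof -
    have q': "q \<noteq> []" "set q \<inter> set p = {}" "is_path W q"
      using q(1) is_path_mono[of X q W] by (auto simp: is_path_def X_def)
    \<comment> \<open>The rerouted path keeps the first i vertices of p and those from position j
      on, \<open>Suc n - j\<close> in number. Either piece is empty when q is attached to the
      corresponding end x or z.\<close>
    define p1 where "p1 = take i p"
    define p2 where "p2 = drop (j - 1) p"
    have len: "length p1 = i" "length p2 + j = Suc n" using ij by (auto simp: p1_def p2_def n_def)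
    have dis: "set p1 \<inter> set p2 = {}"
      unfolding p1_def p2_def using ij by (intro set_take_disj_set_drop_if_distinct p') auto
    have subs: "set p1 \<subseteq> set p" "set p2 \<subseteq> set p" by (auto simp: p1_def p2_def dest: in_set_takeD in_set_dropD)
    have path1: "is_path W p1" if "p1 \<noteq> []"
      using is_path_appendD(1)[of W p1 "drop i p"] p(1) that by (simp add: p1_def)
    have path2: "is_path W p2" if "p2 \<noteq> []"
      using is_path_appendD(2)[of W "take (j - 1) p" p2] p(1) that by (simp add: p2_def)
    have e1: "E (last p1) (hd q)" if "p1 \<noteq> []"
    proof -
      have i: "0 < i" "i \<le> n" using that ij by (auto simp: p1_def)
      then have "last p1 = p ! (i - 1)" using that len by (simp add: last_conv_nth p1_def)
      then show ?thesis using q(2) i by (simp add: B_def)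
    qed
    have e2: "E (last q) (hd p2)" if "p2 \<noteq> []"
    proof -
      have j: "0 < j" "j \<le> n" using that ij by (auto simp: p2_def n_def)
      then have "hd p2 = p ! (j - 1)" using that by (simp add: p2_def hd_drop_conv_nth n_def)
      then show ?thesis using q(3) j by (auto simp: B_def intro: sym)
    qed
    have q2: "is_path W (q @ p2)"
    proof (cases "p2 = []")
      case False
      then show ?thesis using path2 e2 q' subs by (subst is_path_append) auto
    qed (use q' in simp)
    have "is_path W (p1 @ q @ p2)"
    proof (cases "p1 = []")
      case False
      then show ?thesis using path1 e1 q2 q' subs dis by (subst is_path_append) auto
    qed (use q2 in simp)
    moreover have "hd (p1 @ q @ p2) \<in> A"
    proof (cases "i = 0")
      case True
      then show ?thesis using q(2) q'(1) by (simp add: p1_def B_def)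
    next
      case False
      then show ?thesis using p(2) p'(1) by (auto simp: p1_def hd_append)
    qed
    moreover have "last (p1 @ q @ p2) \<in> C"
    proof (cases "j = Suc n")
      case True
      then show ?thesis using q(3) q'(1) by (simp add: p2_def B_def n_def)
    next
      case False
      then have "j - 1 < length p" using ij p'(5) by (auto simp: n_def)
      then show ?thesis using p(3) by (auto simp: p2_def)
    qed
    moreover have "Y \<subseteq> set (p1 @ q @ p2)"
    proof
      fix y assume y: "y \<in> Y"
      then have "y \<in> set p" using Y(2) by auto
      then obtain t where t: "t < n" "p ! t = y" by (auto simp: in_set_conv_nth n_def)
      then have "Suc t \<in> Y'" using y by (simp add: Y'_def)
      then have "\<not> (i < Suc t \<and> Suc t < j)" using ij(3) by auto
      then consider "t < i" | "j - 1 \<le> t" by linarith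
      then show "y \<in> set (p1 @ q @ p2)"
      proof cases
        case 1
        then have "p ! t \<in> set p1" using t by (auto simp: p1_def in_set_conv_nth n_def)
        then show ?thesis using t by auto
      next
        case 2
        then have "p2 ! (t - (j - 1)) = y" "t - (j - 1) < length p2" using t by (auto simp: p2_def n_def)
        then show ?thesis using nth_mem by fastforce
      qed
    qed
    ultimately have "length (p1 @ q @ p2) \<le> n" unfolding n_def by (rule longest)
    then show ?thesis using len by simp
  qed
  \<comment> \<open>A union of components is split until it is connected; both sides are
    additive.\<close>
  have part: "edge_count H H + (\<Sum>i<Suc n. card (H \<inter> B i) + card (H \<inter> B (Suc i))) \<le> Suc n * card H"
    if "H \<subseteq> X" "boundary X H = {}" for H
    using that
  proof (induction "card H" arbitrary: H rule: less_induct)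
    case less
    note H = less.prems
    have finH: "finite H" using H(1) finX finite_subset by blast
    show ?case
    proof (cases "H = {}")
      case True
      then show ?thesis by (simp add: edge_count_def)
    next
      case ne: False
      show ?thesis
      proof (cases "\<exists>K \<subset> H. K \<noteq> {} \<and> boundary H K = {}")
        case True
        then obtain K where K: "K \<subset> H" "K \<noteq> {}" "boundary H K = {}" by blast
        define K' where "K' = H - K"
        have K': "K' \<subset> H" using K by (auto simp: K'_def)
        have "boundary X K = {}" using K H unfolding boundary_def by blast
        moreover have "boundary X K' = {}" using K H sym unfolding K'_def boundary_def by blast
        ultimately have bd: "boundary X K = {}" "boundary X K' = {}" .
        have fin: "finite K" "finite K'" using K K' finH finite_subset by blast+
        have un: "H = K \<union> K'" "K \<inter> K' = {}" using K by (auto simp: K'_def)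
        have "\<not> E v u" if "v \<in> K" "u \<in> K'" for u v
          using K(3) that unfolding boundary_def K'_def by blast
        then have "{u \<in> K'. E v u} = {}" if "v \<in> K" for v using that by blast
        then have "edge_count K K' = 0" using fin by (simp add: edge_count_def)
        then have "edge_count H H = edge_count K K + edge_count K' K'"
          using edge_count_Un[OF fin un(2)] un(1) by simp
        moreover have "card H = card K + card K'" using un fin card_Un_disjoint by metis
        moreover have "card (H \<inter> B i) = card (K \<inter> B i) + card (K' \<inter> B i)" for i
          using un fin by (subst card_Un_disjoint[symmetric]) (auto simp: Int_Un_distrib2)
        ultimately have eqs: "edge_count H H = edge_count K K + edge_count K' K'"
          "card H = card K + card K'" "\<And>i. card (H \<inter> B i) = card (K \<inter> B i) + card (K' \<inter> B i)" .
        have "edge_count K K + (\<Sum>i<Suc n. card (K \<inter> B i) + card (K \<inter> B (Suc i))) \<le> Suc n * card K"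
          using K H bd finH by (intro less.hyps psubset_card_mono) auto
        moreover have "edge_count K' K' + (\<Sum>i<Suc n. card (K' \<inter> B i) + card (K' \<inter> B (Suc i)))
            \<le> Suc n * card K'"
          using K' H bd finH by (intro less.hyps psubset_card_mono) auto
        ultimately show ?thesis
          unfolding eqs by (simp only: sum.distrib add_mult_distrib2)
      next
        case False
        have bd: "boundary X K = boundary H K" if "K \<subseteq> H" for K
          using that H by (auto simp: boundary_def)
        show ?thesis
        proof (rule component_bound[OF finH ne Y'])
          show "K = H" if "K \<subseteq> H" "K \<noteq> {}" "boundary H K = {}" for K using that False by blast
          show "k \<le> card (boundary H K) + card {i. i \<le> Suc n \<and> B i \<inter> K \<noteq> {}}"
            if "K \<subseteq> H" "K \<noteq> {}" for K
            using count[of K] bd[OF that(1)] that H by auto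
          show "i + length q + 1 \<le> j"
            if "i < j" "j \<le> Suc n" "{i<..<j} \<inter> Y' = {}" "is_path H q" "hd q \<in> B i" "last q \<in> B j" for i j q
            using detour that is_path_mono[OF that(4) H(1)] by blast
          show "forces_long_path Z" if "Z \<subseteq> H" "Z \<noteq> {}" for Z
          proof (rule pb)
            show "Z \<subset> W" using that H p'(1) WX by (cases p) auto
          qed (use that in auto)
        qed
      qed
    qed
  qed
  have X_part: "edge_count X X + (\<Sum>i<Suc n. card (X \<inter> B i) + card (X \<inter> B (Suc i))) \<le> Suc n * card X"
    by (rule part) (auto simp: boundary_def)
  have pX: "edge_count (set p) X = (\<Sum>i<n. card (X \<inter> B (Suc i)))"
  proof -
    have "edge_count (set p) X = (\<Sum>i<n. card {u \<in> X. E (p ! i) u})"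
      unfolding edge_count_def n_def
      using bij_betw_nth[OF p'(2) refl refl] by (intro sum.reindex_bij_betw[symmetric])
    also have "\<dots> = (\<Sum>i<n. card (X \<inter> B (Suc i)))"
      by (intro sum.cong refl arg_cong[where f = card]) (auto simp: B_def)
    finally show ?thesis .
  qed
  \<comment> \<open>The vertices of p occur twice, just as the edges between p and X do in
    \<open>edge_count W W\<close>, and the ends once.\<close>
  have sumB: "(\<Sum>i<Suc n. card (X \<inter> B i) + card (X \<inter> B (Suc i))) =
      card (X \<inter> A) + card (X \<inter> C) + 2 * (\<Sum>i<n. card (X \<inter> B (Suc i)))"
    by (simp only: sum.distrib sum.lessThan_Suc_shift[of "\<lambda>i. card (X \<inter> B i)"]
        sum.lessThan_Suc[of "\<lambda>i. card (X \<inter> B (Suc i))"]) (simp add: B_def)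
  have eW: "edge_count W W = edge_count (set p) (set p) + edge_count X X + 2 * edge_count (set p) X"
    using edge_count_Un[OF finp finX WX(2)] WX(1) by simp
  have ep: "edge_count (set p) (set p) \<le> card (set p) * (n - 1)"
  proof -
    have "card {u \<in> set p. E v u} \<le> n - 1" if "v \<in> set p" for v
    proof -
      have "card {u \<in> set p. E v u} \<le> card (set p - {v})"
        using irrefl by (intro card_mono) auto
      then show ?thesis using that p'(2) by (simp add: n_def distinct_card)
    qed
    then show ?thesis
      unfolding edge_count_def using sum_bounded_above[of "set p" "\<lambda>v. card {u \<in> set p. E v u}" "n - 1"] by simp
  qed
  have cp: "card (set p) = n" using p'(2) by (simp add: n_def distinct_card)
  have cW: "card W = card (set p) + card X" using WX finp finX card_Un_disjoint by metis
  have cWZ: "card (W \<inter> Z) = card (set p \<inter> Z) + card (X \<inter> Z)" for Z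
    using WX finp finX by (subst card_Un_disjoint[symmetric]) (auto simp: Int_Un_distrib2)
  have cpZ: "card (set p \<inter> Z) \<le> card (set p)" for Z by (intro card_mono) auto
  \<comment> \<open>Each of the n vertices of p has at most n - 1 neighbours on p and is adjacent to
    at most two ends.\<close>
  have "edge_count W W + card (W \<inter> A) + card (W \<inter> C) \<le>
      n * (n - 1) + 2 * n + Suc n * card X"
    using X_part ep cpZ[of A] cpZ[of C] unfolding sumB eW cWZ pX cp by linarith
  moreover have "n * (n - 1) + 2 * n = n * Suc n" using p'(5) by (cases n) (auto simp: algebra_simps)
  ultimately show ?thesis using cW cp by (simp add: n_def algebra_simps)
qed

text \<open>For a longest path and Y empty, \<open>degree_sum_path_bound\<close> with k = 2 needs
  the claim for proper subsets of W only, which the induction hypothesis provides.\<close>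

lemma long_path_in_rooted_conn:
  assumes "finite W" "W \<noteq> {}"
  shows "forces_long_path W"
  using assms
proof (induction "card W" arbitrary: W rule: less_induct)
  case less
  show ?case
    unfolding forces_long_path_def
  proof (intro allI impI)
    fix A C assume conn: "rooted_conn 2 W A C"
    define P where "P q \<longleftrightarrow> is_path W q \<and> hd q \<in> A \<and> last q \<in> C" for q
    \<comment> \<open>Without boundary vertices, Z can reach the count 2 only through both A and C.
      Applied to \<open>reach W A\<close>, this yields a first path from A to C.\<close>
    have meets: "Z \<inter> A \<noteq> {} \<and> Z \<inter> C \<noteq> {}" if "Z \<subseteq> W" "Z \<noteq> {}" "boundary W Z = {}" for Z
    proof -
      have "2 \<le> card (boundary W Z) + of_bool (Z \<inter> A \<noteq> {}) + of_bool (Z \<inter> C \<noteq> {}) \<or>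
          Z \<union> boundary W Z = W \<and> Z \<inter> A \<noteq> {} \<and> Z \<inter> C \<noteq> {}"
        using conn that(1,2) unfolding rooted_conn_def by blast
      then show ?thesis
        using that(3) by (cases "Z \<inter> A = {}"; cases "Z \<inter> C = {}") simp_all
    qed
    have "W \<inter> A \<noteq> {}" using meets[of W] less.prems by (auto simp: boundary_def)
    then have "reach W A \<noteq> {}" using subset_reach[of A W] by auto
    then have "reach W A \<inter> C \<noteq> {}" using meets[of "reach W A"] reach_subset boundary_reach by blast
    then obtain q0 where "P q0" by (auto simp: P_def reach_def)
    moreover have "length q \<le> card W" if "P q" for q
      using that less.prems(1) is_path_length by (auto simp: P_def)
    ultimately obtain p where p: "P p" "\<And>q. P q \<Longrightarrow> length q \<le> length p"
      using ex_has_greatest_nat[of P q0 length "card W + 1"] by (metis less_Suc_eq_le Suc_eq_plus1)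
    have "edge_count W W + card (W \<inter> A) + card (W \<inter> C) \<le> card W * (length p + 1)"
    proof (rule degree_sum_path_bound[OF less.prems(1) _ conn, of "{}"])
      show "forces_long_path X" if "X \<subset> W" "X \<noteq> {}" for X
        using that less.prems(1) finite_subset
        by (intro less.hyps psubset_card_mono) auto
    qed (use p in \<open>auto simp: P_def\<close>)
    then show "\<exists>q. is_path W q \<and> hd q \<in> A \<and> last q \<in> C \<and>
       edge_count W W + card (W \<inter> A) + card (W \<inter> C) \<le> card W * (length q + 1)"
      using p(1) by (auto simp: P_def)
  qed
qed

text \<open>The theorem for the adjacency relation. The ends are removed and represented by their
  neighbourhoods, and a longest admissible path of V - {x, z} is extended by x and z.\<close>

lemma long_path_through:
  assumes V: "finite V" "k < card V" and k: "2 \<le> k"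
    and conn: "\<And>K. K \<subseteq> V \<Longrightarrow> K \<noteq> {} \<Longrightarrow> card (boundary V K) < k \<Longrightarrow> K \<union> boundary V K = V"
    and xz: "x \<in> V" "z \<in> V" "x \<noteq> z" and Y: "Y \<subseteq> V" "card Y + 2 \<le> k"
  shows "\<exists>P. is_path V P \<and> hd P = x \<and> last P = z \<and> Y \<subseteq> set P \<and>
    (\<Sum>v\<in>V - {x, z}. card {u \<in> V. E v u}) \<le> card (V - {x, z}) * (length P - 1)"
proof -
  define W where "W = V - {x, z}"
  define A where "A = {v. E x v}"
  define C where "C = {v. E z v}"
  define Y0 where "Y0 = Y - {x, z}"
  have W: "finite W" "W \<noteq> {}" "W \<subseteq> V" "x \<notin> W" "z \<notin> W" "V = W \<union> {x, z}"
  proof -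
    have "card W = card V - 2"
      using xz V(1) by (simp add: W_def card_Diff_subset)
    then have "card W \<noteq> 0" using V(2) k by simp
    then show "W \<noteq> {}" by auto
  qed (use V xz in \<open>auto simp: W_def\<close>)
  have cardW: "k - 1 \<le> card W" using V(1,2) xz by (simp add: W_def card_Diff_subset)
  have finY: "finite Y" using Y(1) V(1) finite_subset by blast
  have Y0: "Y0 \<subseteq> W" "card Y0 + 2 \<le> k"
    using Y card_mono[OF finY, of Y0] by (auto simp: Y0_def W_def)

  have rooted: "rooted_conn k W A C"
    unfolding rooted_conn_def
  proof (intro allI impI)
    fix K assume K: "K \<subseteq> W" "K \<noteq> {}"
    have bd: "boundary V K = boundary W K \<union> (if K \<inter> A \<noteq> {} then {x} else {}) \<union> (if K \<inter> C \<noteq> {} then {z} else {})"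
      using K W xz by (auto simp: boundary_def A_def C_def intro: sym)
    have "finite (boundary W K)" "x \<notin> boundary W K" "z \<notin> boundary W K"
      using W by (auto simp: boundary_def)
    then have card_bd: "card (boundary V K) =
        card (boundary W K) + of_bool (K \<inter> A \<noteq> {}) + of_bool (K \<inter> C \<noteq> {})"
      unfolding bd using xz(3) by (simp add: card_insert_if)
    show "k \<le> card (boundary W K) + of_bool (K \<inter> A \<noteq> {}) + of_bool (K \<inter> C \<noteq> {}) \<or>
      K \<union> boundary W K = W \<and> K \<inter> A \<noteq> {} \<and> K \<inter> C \<noteq> {}"
    proof (cases "k \<le> card (boundary V K)")
      case True
      then show ?thesis unfolding card_bd by blast
    next
      case False
      then have all: "K \<union> boundary V K = V" using conn[of K] K W(3) by auto
      have "x \<in> boundary V K" "z \<in> boundary V K" using all xz K W(4,5) by blast+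
      then have "K \<inter> A \<noteq> {}" "K \<inter> C \<noteq> {}"
        using sym K by (auto simp: boundary_def A_def C_def)
      moreover have "K \<union> boundary W K = W"
      proof
        show "W \<subseteq> K \<union> boundary W K"
        proof
          fix v assume v: "v \<in> W"
          then have "v \<in> K \<union> boundary V K" using all W(3) by blast
          then show "v \<in> K \<union> boundary W K" using v by (auto simp: boundary_def)
        qed
      qed (use K in \<open>auto simp: boundary_def\<close>)
      ultimately show ?thesis by blast
    qed
  qed

  \<comment> \<open>Enlarging to k - 1 vertices makes the interior p0 of the first path nonempty,
    also for k = 2, and long enough for \<open>degree_sum_path_bound\<close>; a longest path
    inherits this.\<close>
  obtain Y1 where Y1: "Y0 \<subseteq> Y1" "Y1 \<subseteq> W" "card Y1 = k - 1"
  proof -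
    have "card Y0 \<le> k - 1" using Y0(2) by simp
    then show thesis using exists_subset_between[OF _ cardW Y0(1) W(1)] that by blast
  qed
  have "\<exists>P. is_path V P \<and> hd P = x \<and> last P = z \<and> Y1 \<subseteq> set P"
    using Y1 k by (intro path_through_set[OF V(1) conn xz, of k Y1]) (auto simp: W_def)
  then obtain P0 where P0: "is_path V P0" "hd P0 = x" "last P0 = z" "Y1 \<subseteq> set P0" by blast
  obtain p0 where p0: "P0 = x # p0 @ [z]"
  proof -
    obtain t where t: "P0 = x # t" using P0(1,2) by (cases P0) (auto simp: is_path_def)
    then have "t \<noteq> []" using P0(3) xz(3) by auto
    then have "t = butlast t @ [z]" using P0(3) t by (metis append_butlast_last_id last_ConsR)
    then show thesis using that t by metis
  qed
  have "Y1 \<subseteq> set p0" using P0(4) Y1(2) W(4,5) unfolding p0 by auto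
  then have len0: "k \<le> length p0 + 2" and p0_ne: "p0 \<noteq> []"
    using Y1(3) k card_length[of p0] card_mono[of "set p0" Y1] by auto
  define Q where "Q q \<longleftrightarrow> is_path W q \<and> hd q \<in> A \<and> last q \<in> C \<and> Y0 \<subseteq> set q" for q
  have "Q p0"
  proof -
    have "is_path V (p0 @ [z])" "x \<notin> set (p0 @ [z])" "E x (hd p0)"
      using P0(1) p0_ne unfolding p0 by (auto simp: is_path_def successively_Cons)
    moreover from this(1) have "is_path V p0" "z \<notin> set p0" "E (last p0) z"
      using p0_ne is_path_append[of p0 "[z]" V] by auto
    ultimately show ?thesis
      using \<open>Y1 \<subseteq> set p0\<close> Y1(1) sym[of "last p0" z] by (auto simp: Q_def is_path_def W_def A_def C_def)
  qed
  moreover have "length q \<le> card W" if "Q q" for q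
    using that W(1) is_path_length by (auto simp: Q_def)
  ultimately obtain p where p: "Q p" "\<And>q. Q q \<Longrightarrow> length q \<le> length p"
    using ex_has_greatest_nat[of Q p0 length "card W + 1"] by (metis less_Suc_eq_le Suc_eq_plus1)
  have bound: "edge_count W W + card (W \<inter> A) + card (W \<inter> C) \<le> card W * (length p + 1)"
  proof (rule degree_sum_path_bound[OF W(1) k rooted Y0(2)])
    show "k \<le> length p + 2" using p(2)[OF \<open>Q p0\<close>] len0 by simp
    show "forces_long_path X" if "X \<subset> W" "X \<noteq> {}" for X
      using that W(1) finite_subset by (intro long_path_in_rooted_conn) auto
    show "length q \<le> length p" if "is_path W q" "hd q \<in> A" "last q \<in> C" "Y0 \<subseteq> set q" for q
      using p(2) that by (simp add: Q_def)
  qed (use p(1) in \<open>auto simp: Q_def\<close>)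

  have pW: "is_path W p" "p \<noteq> []" "E x (hd p)" "E (last p) z" "Y0 \<subseteq> set p"
    using p(1) sym by (auto simp: Q_def A_def C_def is_path_def)
  have sW: "set p \<subseteq> W" using pW(1) by (simp add: is_path_def)
  have "is_path V (p @ [z])"
    using pW is_path_mono[OF pW(1) W(3)] xz(2) sW W(5) by (subst is_path_append) (auto simp: is_path_def)
  then have path: "is_path V ([x] @ p @ [z])"
    using pW xz(1,3) sW W(4) by (subst is_path_append) (auto simp: is_path_def)
  have deg: "card {u \<in> V. E v u} = card {u \<in> W. E v u} + of_bool (E v x) + of_bool (E v z)" for v
  proof -
    have "{u \<in> V. E v u} = {u \<in> W. E v u} \<union> (if E v x then {x} else {}) \<union> (if E v z then {z} else {})"
      unfolding W(6) by auto
    then show ?thesis using W(1,4,5) xz(3) by (simp add: card_insert_if)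
  qed
  have nbr: "W \<inter> {v. E v x} = W \<inter> A" "W \<inter> {v. E v z} = W \<inter> C"
    using sym by (auto simp: A_def C_def)
  have "(\<Sum>v\<in>W. card {u \<in> V. E v u}) = edge_count W W + card (W \<inter> A) + card (W \<inter> C)"
    unfolding deg using W(1) by (simp add: sum.distrib edge_count_def nbr)
  then have "(\<Sum>v\<in>W. card {u \<in> V. E v u}) \<le> card W * (length ([x] @ p @ [z]) - 1)"
    using bound by simp
  moreover have "Y \<subseteq> set ([x] @ p @ [z])" using pW(5) by (auto simp: Y0_def)
  ultimately show ?thesis using path unfolding W_def[symmetric]
    by (intro exI[of _ "[x] @ p @ [z]"]) simp
qed

end

section \<open>Transfer to symmetric digraphs\<close>

lemma out_degree_eq_card_neighbours:
  assumes "graph G"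
  shows "out_degree G v = card {u \<in> verts G. v \<rightarrow>\<^bsub>G\<^esub> u}"
proof -
  interpret graph G by fact
  have "bij_betw (head G) (out_arcs G v) {u \<in> verts G. v \<rightarrow>\<^bsub>G\<^esub> u}"
    unfolding bij_betw_def
  proof
    show "inj_on (head G) (out_arcs G v)"
      by (auto simp: inj_on_def arc_to_ends_def intro!: no_multi_arcs)
    show "head G ` out_arcs G v = {u \<in> verts G. v \<rightarrow>\<^bsub>G\<^esub> u}"
      by (auto simp: arcs_ends_def arc_to_ends_def)
  qed
  then show ?thesis unfolding out_degree_def by (rule bij_betw_same_card)
qed

text \<open>Connectivity is reachability in the symmetric closure. Since G is symmetric, the arcs of
  that closure are arcs of G, and a walk starting in K never leaves K.\<close>

lemma (in graph) connected_induce_closed: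
  assumes conn: "Digraph_Component.connected (G \<restriction> U)" and K: "K \<subseteq> U" "K \<noteq> {}"
    and closed: "\<And>u v. u \<in> K \<Longrightarrow> v \<in> U \<Longrightarrow> u \<rightarrow>\<^bsub>G\<^esub> v \<Longrightarrow> v \<in> K"
  shows "K = U"
proof
  let ?H = "with_proj (mk_symmetric (G \<restriction> U))"
  show "U \<subseteq> K"
  proof
    fix v assume v: "v \<in> U"
    obtain u where u: "u \<in> K" using K(2) by blast
    then have "u \<rightarrow>\<^sup>*\<^bsub>?H\<^esub> v"
      using conn v K(1) unfolding connected_def strongly_connected_def by auto
    then have "(u, v) \<in> (arcs_ends ?H)\<^sup>*" by (rule reachable_rtranclI)
    then show "v \<in> K"
    proof (induction rule: rtrancl_induct)
      case base
      show ?case by (rule u)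
    next
      case (step a b)
      then have ab: "(a, b) \<in> parcs (mk_symmetric (G \<restriction> U))" by simp
      then have "b \<in> U" by (auto simp: parcs_mk_symmetric)
      moreover have "a \<rightarrow>\<^bsub>G\<^esub> b"
        using ab by (auto simp: parcs_mk_symmetric intro: arcs_ends_symmetric in_arcs_imp_in_arcs_ends)
      ultimately show ?case using closed step.IH by blast
    qed
  qed
qed (rule K(1))

lemma (in adjacency) is_path_imp_vpath:
  assumes "\<And>u v. E u v \<Longrightarrow> u \<rightarrow>\<^bsub>G\<^esub> v" and p: "is_path (verts G) p"
  shows "vpath p G"
proof -
  have "successively E q \<Longrightarrow> set (vwalk_arcs q) \<subseteq> arcs_ends G" for q
    using assms(1) by (induction q rule: vwalk_arcs.induct) auto
  then show ?thesis using p by (auto simp: is_path_def vpath_def vwalk_def)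
qed

theorem theorem4:
  fixes G :: "('a, 'b) pre_digraph" and k :: nat and x z :: 'a and Y :: "'a set" and r :: real
  assumes "graph G"
    and "k \<ge> 2"
    and "k_connected k G"
    and "x \<in> verts G" and "z \<in> verts G" and "x \<noteq> z"
    and "average_degree_on G (verts G - {x, z}) \<ge> r"
    and "Y \<subseteq> verts G" and "card Y = k - 2"
  shows "\<exists>p. path_through G x Y z p \<and> real (vwalk_length p) \<ge> r"
proof -
  interpret graph G by fact
  let ?V = "verts G" and ?W = "verts G - {x, z}"
  interpret adjacency "\<lambda>u v. u \<rightarrow>\<^bsub>G\<^esub> v"
    by unfold_locales (auto intro: arcs_ends_symmetric dest: adj_not_same)
  have card_V: "k < card ?V"
    and cut: "\<And>S. S \<subseteq> ?V \<Longrightarrow> card S < k \<Longrightarrow> Digraph_Component.connected (G \<restriction> (?V - S))"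
    using assms(3) by (auto simp: k_connected_def)
  have conn: "K \<union> boundary ?V K = ?V" if K: "K \<subseteq> ?V" "K \<noteq> {}" "card (boundary ?V K) < k" for K
  proof -
    \<comment> \<open>Deleting fewer than k boundary vertices leaves a connected graph, in which K
      is closed under adjacency.\<close>
    have "K = ?V - boundary ?V K"
    proof (rule connected_induce_closed)
      show "Digraph_Component.connected (G \<restriction> (?V - boundary ?V K))"
        using K by (intro cut) (auto simp: boundary_def)
    qed (use K in \<open>auto simp: boundary_def\<close>)
    then show ?thesis by (auto simp: boundary_def)
  qed
  obtain P where P: "is_path ?V P" "hd P = x" "last P = z" "Y \<subseteq> set P"
    and len: "(\<Sum>v\<in>?W. card {u \<in> ?V. v \<rightarrow>\<^bsub>G\<^esub> u}) \<le> card ?W * (length P - 1)"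
  proof -
    have "card Y + 2 \<le> k" using assms(2,9) by simp
    then show thesis
      using long_path_through[OF finite_verts card_V assms(2) conn assms(4-6,8)] that by blast
  qed
  \<comment> \<open>The average has a nonzero denominator, since G has more than two
    vertices.\<close>
  have "card ?W = card ?V - 2" using assms(4-6) by (simp add: card_Diff_subset)
  then have W_pos: "0 < card ?W" using card_V assms(2) by simp
  have "(\<Sum>v\<in>?W. real (out_degree G v)) = real (\<Sum>v\<in>?W. card {u \<in> ?V. v \<rightarrow>\<^bsub>G\<^esub> u})"
    using assms(1) by (simp add: out_degree_eq_card_neighbours)
  also have "\<dots> \<le> real (card ?W * (length P - 1))"
    using len by (simp only: of_nat_le_iff)
  finally have "average_degree_on G ?W \<le> real (length P - 1)"
    using W_pos by (simp add: average_degree_on_def divide_le_eq mult.commute)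
  moreover have "path_through G x Y z P"
    using P is_path_imp_vpath by (simp add: path_through_def)
  ultimately show ?thesis using assms(7) by (intro exI[of _ P]) simp
qed

end
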